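(* Let $F(x)=x\int_x^\infty K_{5/3}(z)\,dz$ for $x>0$ be the synchrotron function. For every integer $N\ge0$, as $x\to\infty$, $$F(x)=\sqrt{\frac{x}{\pi}}\,e^{-x}\left(\sum_{n=0}^{N}\sum_{m=0}^{N}\frac{\Gamma\!\left(\frac12+n+m\right)\Gamma\!\left(-\frac76+m\right)\Gamma\!\left(\frac{13}{6}+m\right)}{2^{3/2+m}\,m!\,\Gamma\!\left(\frac12+m\right)}\left(-\frac1x\right)^{m}\left(-\frac1x\right)^{n}+\mathcal{O}\!\left(\frac{1}{x^{N+1}}\right)\right).$$ In particular (case $N=2$), as $x\to\infty$, $$F(x)=\sqrt{\frac{\pi x}{2}}\,e^{-x}\left[1+\frac{55}{72}\,\frac1x-\frac{10151}{10368}\,\frac1{x^2}+\mathcal{O}\!\left(\frac1{x^3}\right)\right].$$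
   Context: $K_\nu$ denotes the modified Bessel function of the second kind, $K_\nu(x)=\frac{\pi}{2}\frac{I_{-\nu}(x)-I_\nu(x)}{\sin(\nu\pi)}$ for non-integer $\nu$ and $x>0$, where $I_\nu$ is the modified Bessel function of the first kind. $\Gamma$ is the Gamma function. *)

theory Defs
  imports "HOL-Analysis.Analysis" "HOL-Library.Landau_Symbols"
begin

(* Writing the coefficients with rGamma = 1/Gamma makes the terms at the poles
   of Gamma vanish. *)
definition bessel_I :: "real \<Rightarrow> real \<Rightarrow> real" where
  "bessel_I \<nu> x =
     (\<Sum>k. (x / 2) powr (2 * real k + \<nu>) * rGamma (real k + \<nu> + 1) / fact k)"

(* Meant for x > 0 and non-integer order only: at integer orders the
   denominator vanishes and the value is not that of the Bessel function. *)
definition bessel_K :: "real \<Rightarrow> real \<Rightarrow> real" where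
  "bessel_K \<nu> x = pi / 2 * ((bessel_I (- \<nu>) x - bessel_I \<nu> x) / sin (\<nu> * pi))"

definition synchrotron_F :: "real \<Rightarrow> real" where
  "synchrotron_F x = x * (LBINT z:{x..}. bessel_K (5/3) z)"

end

theory Submission
  imports Defs "HOL-Probability.Distributions" "HOL-Real_Asymp.Real_Asymp"
begin

text \<open>
  For \<open>0 < a < 1\<close> the integral \<open>H\<^sub>a(y)\<close> of \<open>t powr (a - 1) * exp (- t - y / t)\<close> over \<open>t > 0\<close> solves the
  differential equation of \<open>0F1\<close>, and its behaviour at \<open>y \<rightarrow> 0\<close> determines the Wronskians with the
  two power series solutions, hence the coefficients of \<open>H\<^sub>a\<close> in terms of these. Taking \<open>a = 1/3\<close>
  and differentiating twice gives \<open>K\<^sub>\<nu>(x) = \<integral> cosh (\<nu> u) exp (- x cosh u) du\<close> over \<open>u > 0\<close>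
  for \<open>\<nu> = 5/3\<close>. Integrating in \<open>x\<close> and substituting \<open>u = 2 arsinh w\<close> gives a Gaussian integral
  \<open>F(x) = x e\<^sup>-\<^sup>x \<integral> exp (- 2 x w\<^sup>2) q(w) / (1 + 2 w\<^sup>2) dw\<close> over the real line. The two summation
  indices come from the Taylor series of \<open>q\<close> (index \<open>m\<close>) and the geometric series of
  \<open>1 / (1 + 2 w\<^sup>2)\<close> (index \<open>n\<close>), integrated termwise against the Gaussian as in Watson's lemma.
\<close>

section \<open>The regularized hypergeometric function 0F1\<close>

text \<open>With \<open>y = x\<^sup>2 / 4\<close> the function \<open>I\<^sub>\<nu>(x)\<close> is \<open>(x / 2)\<^sup>\<nu>\<close> times \<open>hyp01 (\<nu> + 1) y\<close>. In this
  variable differentiation is a shift of the parameter.\<close>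

definition hyp01 :: "real \<Rightarrow> real \<Rightarrow> real" where
  "hyp01 b y = (\<Sum>k. rGamma (real k + b) / fact k * y ^ k)"

lemma rGamma_real_plus1: "(z::real) * rGamma (z + 1) = rGamma z"
  using rGamma_plus1[of z] by simp

lemma rGamma_reflection_real: "rGamma a * rGamma (1 - a :: real) = sin (pi * a) / pi"
proof -
  have "complex_of_real (rGamma a * rGamma (1 - a)) = of_real (sin (pi * a) / pi)"
    using rGamma_reflection_complex[of "of_real a"]
    by (simp flip: rGamma_complex_of_real sin_of_real)
  then show ?thesis by (simp only: of_real_eq_iff)
qed

lemma summable_hyp01: "summable (\<lambda>k. rGamma (real k + b) / fact k * y ^ k)"
proof (rule summable_ratio_test)
  \<comment> \<open>From this index on, \<open>k + b >= 1\<close> and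
    \<open>k + 1 >= 2 * abs y\<close>. The quotient of consecutive terms,
    \<open>abs y / ((k + b) * (k + 1))\<close>, is then at most 1/2.\<close>
  let ?N = "nat \<lceil>\<bar>b\<bar> + 1 + 2 * \<bar>y\<bar>\<rceil>"
  show "(1/2::real) < 1" by simp
  fix k assume "?N \<le> k"
  then have k: "real k \<ge> \<bar>b\<bar> + 1 + 2 * \<bar>y\<bar>" by linarith
  have kb: "real k + b \<ge> 1" using k by linarith
  have r: "rGamma (real k + b) = (real k + b) * rGamma (real (Suc k) + b)"
    using rGamma_real_plus1[of "real k + b"] by (simp add: add_ac)
  have "2 * \<bar>y\<bar> \<le> real k + 1" using k by linarith
  also have "\<dots> \<le> (real k + b) * (real k + 1)"
    using mult_right_mono[OF kb, of "real k + 1"] by simp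
  finally have *: "\<bar>y\<bar> \<le> 1/2 * ((real k + b) * (real k + 1))" by simp
  have "norm (rGamma (real (Suc k) + b) / fact (Suc k) * y ^ Suc k)
        = \<bar>rGamma (real (Suc k) + b)\<bar> * \<bar>y\<bar> ^ k / (fact k * (real k + 1)) * \<bar>y\<bar>"
    by (simp add: abs_mult power_abs field_simps)
  also have "\<dots> \<le> \<bar>rGamma (real (Suc k) + b)\<bar> * \<bar>y\<bar> ^ k / (fact k * (real k + 1)) * (1/2 * ((real k + b) * (real k + 1)))"
    by (intro mult_left_mono *) auto
  also have "\<dots> = \<bar>rGamma (real (Suc k) + b)\<bar> * \<bar>y\<bar> ^ k / fact k * (1/2 * (real k + b))"
    by (simp del: of_nat_Suc add: divide_simps)
  also have "\<dots> = 1/2 * norm (rGamma (real k + b) / fact k * y ^ k)"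
    unfolding r using kb by (simp add: abs_mult power_abs mult_ac)
  finally show "norm (rGamma (real (Suc k) + b) / fact (Suc k) * y ^ Suc k)
     \<le> 1/2 * norm (rGamma (real k + b) / fact k * y ^ k)" .
qed

lemma diffs_hyp01:
  "diffs (\<lambda>k. rGamma (real k + b) / fact k) = (\<lambda>k. rGamma (real k + (b + 1)) / fact k :: real)"
proof
  fix k
  have "real (Suc k) * (rGamma (real (Suc k) + b) / fact (Suc k)) = rGamma (real (Suc k) + b) / fact k"
    by (simp del: of_nat_Suc)
  then show "diffs (\<lambda>k. rGamma (real k + b) / fact k) k = rGamma (real k + (b + 1)) / fact k"
    by (simp add: diffs_def add_ac)
qed

lemma hyp01_has_derivative [derivative_intros]:
  "(hyp01 b has_real_derivative hyp01 (b + 1) y) (at y within A)"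
proof -
  have "DERIV (\<lambda>y. \<Sum>k. rGamma (real k + b) / fact k * y ^ k) y :>
      (\<Sum>k. diffs (\<lambda>k. rGamma (real k + b) / fact k) k * y ^ k)"
    by (intro termdiffs_strong_converges_everywhere summable_hyp01)
  then have "(hyp01 b has_real_derivative hyp01 (b + 1) y) (at y)"
    unfolding diffs_hyp01 hyp01_def[abs_def] .
  then show ?thesis by (rule has_field_derivative_at_within)
qed

lemma hyp01_0: "hyp01 b 0 = rGamma b"
  unfolding hyp01_def using powser_zero[of "\<lambda>k. rGamma (real k + b) / fact k"] by simp

text \<open>As differentiation raises the parameter by one, this is the differential equation
  \<open>y * f'' + b * f' = f\<close> for \<open>f = hyp01 b\<close>. On coefficients it reduces to
  \<open>z * rGamma (z + 1) = rGamma z\<close> with \<open>z = k + b\<close>.\<close>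

lemma hyp01_rec: "y * hyp01 (b + 2) y + b * hyp01 (b + 1) y = hyp01 b y"
proof -
  define d where "d = (\<lambda>k. rGamma (real k + (b + 1)) / fact k)"
  have dd: "diffs d = (\<lambda>k. rGamma (real k + (b + 2)) / fact k)"
    unfolding d_def diffs_hyp01 by (simp add: add_ac)
  have "(\<lambda>k. real k * d k * y ^ (k - Suc 0)) sums (\<Sum>k. diffs d k * y ^ k)"
    using diffs_equiv[of d y] summable_hyp01[of "b + 2" y] dd by simp
  then have "(\<lambda>k. y * (real k * d k * y ^ (k - Suc 0))) sums (y * hyp01 (b + 2) y)"
    unfolding dd hyp01_def by (rule sums_mult)
  moreover have "(\<lambda>k. b * (d k * y ^ k)) sums (b * hyp01 (b + 1) y)"
    unfolding hyp01_def d_def by (intro sums_mult summable_sums summable_hyp01)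
  ultimately have "(\<lambda>k. y * (real k * d k * y ^ (k - Suc 0)) + b * (d k * y ^ k)) sums
      (y * hyp01 (b + 2) y + b * hyp01 (b + 1) y)" by (rule sums_add)
  moreover have "y * (real k * d k * y ^ (k - Suc 0)) + b * (d k * y ^ k)
      = rGamma (real k + b) / fact k * y ^ k" for k
  proof -
    \<comment> \<open>At \<open>k = 0\<close> the truncated exponent is harmless because the factor
      \<open>k\<close> vanishes.\<close>
    have "y * (real k * d k * y ^ (k - Suc 0)) = real k * d k * y ^ k"
      by (cases k) auto
    then have "y * (real k * d k * y ^ (k - Suc 0)) + b * (d k * y ^ k)
        = (real k + b) * d k * y ^ k"
      by (simp add: algebra_simps)
    also have "(real k + b) * d k = rGamma (real k + b) / fact k"
      using rGamma_real_plus1[of "real k + b"] by (simp add: d_def add_ac)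
    finally show ?thesis .
  qed
  ultimately show ?thesis
    by (simp add: hyp01_def sums_iff)
qed

text \<open>For \<open>y > 0\<close> this is \<open>y powr (1 - a)\<close> times the Wronskian of
  \<open>hyp01 (1 - a) y\<close> and \<open>y powr a * hyp01 (1 + a) y\<close>, two solutions of
  \<open>y * f'' + (1 - a) * f' = f\<close>. It is constant, and its value at 0 comes from the
  reflection formula.\<close>

lemma hyp01_wronskian:
  "hyp01 (1 - a) y * hyp01 a y - y * hyp01 (2 - a) y * hyp01 (1 + a) y = sin (pi * a) / pi"
proof -
  let ?f = "\<lambda>y. hyp01 (1 - a) y * hyp01 a y - y * hyp01 (2 - a) y * hyp01 (1 + a) y"
  have e: "1 - a + 1 = 2 - a" "2 - a + 1 = 3 - a" "1 - a + 2 = 3 - a" "1 + a + 1 = a + 2" "a + 1 = 1 + a"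
    by auto
  have "DERIV ?f y :> 0" for y
  proof -
    have r1: "y * hyp01 (3 - a) y = hyp01 (1 - a) y - (1 - a) * hyp01 (2 - a) y"
      using hyp01_rec[of y "1 - a"] unfolding e by simp
    have r2: "y * hyp01 (a + 2) y = hyp01 a y - a * hyp01 (1 + a) y"
      using hyp01_rec[of y a] unfolding e by simp
    have "DERIV ?f y :> hyp01 (1 - a) y * hyp01 (1 + a) y + hyp01 (2 - a) y * hyp01 a y -
        (hyp01 (2 - a) y * hyp01 (1 + a) y + (y * hyp01 (3 - a) y) * hyp01 (1 + a) y
         + (y * hyp01 (a + 2) y) * hyp01 (2 - a) y)"
      by (auto intro!: derivative_eq_intros simp: e algebra_simps)
    also have "hyp01 (1 - a) y * hyp01 (1 + a) y + hyp01 (2 - a) y * hyp01 a y -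
        (hyp01 (2 - a) y * hyp01 (1 + a) y + (y * hyp01 (3 - a) y) * hyp01 (1 + a) y
         + (y * hyp01 (a + 2) y) * hyp01 (2 - a) y) = 0"
      unfolding r1 r2 by (simp add: algebra_simps)
    finally show ?thesis .
  qed
  then have "?f y = ?f 0" by (intro DERIV_isconst_all) blast
  also have "\<dots> = rGamma a * rGamma (1 - a)" by (simp add: hyp01_0)
  also have "\<dots> = sin (pi * a) / pi" by (rule rGamma_reflection_real)
  finally show ?thesis .
qed

section \<open>Differentiation of exponential integrals in the parameter\<close>

lemma abs_exp_minus_one_minus_le: "\<bar>exp z - 1 - z\<bar> \<le> z\<^sup>2 * exp \<bar>z\<bar>" for z :: real
proof -
  obtain t where t: "\<bar>t\<bar> \<le> \<bar>z\<bar>" "exp z = (\<Sum>m<2. z ^ m / fact m) + exp t / fact 2 * z ^ 2"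
    using Maclaurin_exp_le[of z 2] by blast
  have "exp z - 1 - z = exp t / 2 * z\<^sup>2" using t(2) by (simp add: numeral_2_eq_2)
  then have "\<bar>exp z - 1 - z\<bar> = exp t / 2 * z\<^sup>2" by (simp only: abs_mult) simp
  also have "\<dots> \<le> exp \<bar>z\<bar> * z\<^sup>2"
  proof (rule mult_right_mono)
    have "exp t \<le> exp \<bar>z\<bar>" using t(1) by simp
    then show "exp t / 2 \<le> exp \<bar>z\<bar>" using exp_ge_zero[of t] by linarith
  qed simp
  finally show ?thesis by (simp add: mult.commute)
qed

lemma power_times_exp_le: "z ^ n * exp (- z) \<le> fact n" if "z \<ge> 0" for z :: real
proof -
  have "z ^ n / fact n \<le> exp z"
    unfolding exp_def using that summable_exp_generic[of z]
    by (intro order_trans[OF _ sum_le_suminf[of _ "{n}"]]) (auto simp: field_simps)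
  then show ?thesis by (simp add: exp_minus field_simps)
qed

text \<open>The exponential is split into two equal halves: one bounds the power of
  \<open>c u\<close> by \<open>fact n * (2 / y) ^ n\<close>, the other keeps the integrand
  integrable.\<close>

lemma integrable_power_times_exp:
  fixes g c :: "'a \<Rightarrow> real"
  assumes [measurable]: "g \<in> borel_measurable M" "c \<in> borel_measurable M"
    and c: "\<And>u. c u \<ge> 0"
    and int: "\<And>y. y > 0 \<Longrightarrow> integrable M (\<lambda>u. g u * exp (- (y * c u)))"
    and y: "y > 0"
  shows "integrable M (\<lambda>u. g u * c u ^ n * exp (- (y * c u)))"
proof (rule Bochner_Integration.integrable_bound)
  show "integrable M (\<lambda>u. fact n * (2 / y) ^ n * (g u * exp (- (y / 2 * c u))))"
    using int[of "y / 2"] y by simp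
  show "AE u in M. norm (g u * c u ^ n * exp (- (y * c u)))
      \<le> norm (fact n * (2 / y) ^ n * (g u * exp (- (y / 2 * c u))))"
  proof (rule AE_I2)
    fix u
    let ?z = "y / 2 * c u"
    have z: "?z \<ge> 0" using y c[of u] by simp
    have "norm (g u * c u ^ n * exp (- (y * c u)))
        = \<bar>g u\<bar> * exp (- ?z) * ((2 / y) ^ n * (?z ^ n * exp (- ?z)))"
      using y c[of u] by (simp add: abs_mult field_simps power_mult_distrib flip: exp_add)
    also have "\<dots> \<le> \<bar>g u\<bar> * exp (- ?z) * ((2 / y) ^ n * fact n)"
      using y by (intro mult_left_mono power_times_exp_le z) auto
    finally show "norm (g u * c u ^ n * exp (- (y * c u)))
      \<le> norm (fact n * (2 / y) ^ n * (g u * exp (- (y / 2 * c u))))"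
      using y by (simp add: abs_mult mult_ac)
  qed
qed measurable

text \<open>The first-order Taylor error of the integrand is at most \<open>h^2\<close> times a
  fixed integrable function: for \<open>abs h < y / 2\<close> the factor
  \<open>exp (abs h * c u)\<close> costs at most half of the exponent. The same lemma later
  differentiates the integrals \<open>H_a\<close>, the cosh integral and the Gaussian
  moments.\<close>

lemma has_derivative_exp_integral:
  fixes g c :: "'a \<Rightarrow> real"
  assumes [measurable]: "g \<in> borel_measurable M" "c \<in> borel_measurable M"
    and c: "\<And>u. c u \<ge> 0"
    and int: "\<And>y. y > 0 \<Longrightarrow> integrable M (\<lambda>u. g u * exp (- (y * c u)))"
    and y: "y > 0"
  shows "((\<lambda>y. \<integral>u. g u * exp (- (y * c u)) \<partial>M) has_real_derivative
      - (\<integral>u. g u * c u * exp (- (y * c u)) \<partial>M)) (at y)"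
proof -
  let ?F = "\<lambda>y. \<integral>u. g u * exp (- (y * c u)) \<partial>M"
  let ?D = "\<integral>u. g u * c u * exp (- (y * c u)) \<partial>M"
  define C where "C = (\<integral>u. \<bar>g u * c u ^ 2 * exp (- (y / 2 * c u))\<bar> \<partial>M)"
  have i1: "integrable M (\<lambda>u. g u * c u * exp (- (y * c u)))"
    using integrable_power_times_exp[OF assms, of 1] by simp
  have i2: "integrable M (\<lambda>u. \<bar>g u * c u ^ 2 * exp (- (y / 2 * c u))\<bar>)"
    using integrable_power_times_exp[OF assms(1-4), of "y / 2" 2] y by simp
  have bd: "\<bar>?F (y + h) - ?F y + h * ?D\<bar> \<le> C * h\<^sup>2" if h: "\<bar>h\<bar> < y / 2" for h
  proof -
    have ih: "integrable M (\<lambda>u. g u * exp (- ((y + h) * c u)))"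
      using h y by (intro int) linarith
    have iy: "integrable M (\<lambda>u. g u * exp (- (y * c u)))" using int y by simp
    let ?r = "\<lambda>u. g u * exp (- ((y + h) * c u)) - g u * exp (- (y * c u)) + h * (g u * c u * exp (- (y * c u)))"
    have "\<bar>?F (y + h) - ?F y + h * ?D\<bar> = \<bar>\<integral>u. ?r u \<partial>M\<bar>"
      using ih iy i1 by simp
    also have "\<dots> \<le> (\<integral>u. \<bar>?r u\<bar> \<partial>M)" by (rule integral_abs_bound)
    also have "\<dots> \<le> (\<integral>u. h\<^sup>2 * \<bar>g u * c u ^ 2 * exp (- (y / 2 * c u))\<bar> \<partial>M)"
    proof (rule integral_mono)
      fix u
      have "?r u = g u * exp (- (y * c u)) * (exp (- h * c u) - 1 - (- h * c u))"
      proof -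
        have "exp (- ((y + h) * c u)) = exp (- (y * c u)) * exp (- h * c u)"
          unfolding exp_add[symmetric] by (simp add: algebra_simps)
        then show ?thesis by (simp only:) (simp add: algebra_simps)
      qed
      then have "\<bar>?r u\<bar> = \<bar>g u\<bar> * exp (- (y * c u)) * \<bar>exp (- h * c u) - 1 - (- h * c u)\<bar>"
        by (simp only: abs_mult abs_exp_cancel)
      also have "\<dots> \<le> \<bar>g u\<bar> * exp (- (y * c u)) * ((- h * c u)\<^sup>2 * exp \<bar>- h * c u\<bar>)"
        by (intro mult_left_mono abs_exp_minus_one_minus_le) auto
      also have "\<dots> = \<bar>g u\<bar> * (h * c u)\<^sup>2 * (exp (- (y * c u)) * exp \<bar>- h * c u\<bar>)"
        by simp
      also have "\<dots> \<le> \<bar>g u\<bar> * (h * c u)\<^sup>2 * exp (- (y / 2 * c u))"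
      proof (intro mult_left_mono)
        have "\<bar>h\<bar> * c u \<le> y / 2 * c u" using h c[of u] by (intro mult_right_mono) auto
        then show "exp (- (y * c u)) * exp \<bar>- h * c u\<bar> \<le> exp (- (y / 2 * c u))"
          unfolding exp_add[symmetric] using c[of u] by (simp add: abs_mult)
      qed auto
      finally show "\<bar>?r u\<bar> \<le> h\<^sup>2 * \<bar>g u * c u ^ 2 * exp (- (y / 2 * c u))\<bar>"
        by (simp add: abs_mult power_mult_distrib mult_ac)
    qed (use ih iy i1 i2 in auto)
    also have "\<dots> = C * h\<^sup>2" unfolding C_def by simp
    finally show ?thesis .
  qed
  have "((\<lambda>h. (?F (y + h) - ?F y) / h - (- ?D)) \<longlongrightarrow> 0) (at 0)"
  proof (rule Lim_null_comparison)
    show "\<forall>\<^sub>F h in at 0. norm ((?F (y + h) - ?F y) / h - (- ?D)) \<le> C * \<bar>h\<bar>"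
      unfolding eventually_at
    proof (intro exI[of _ "y / 2"] conjI ballI impI)
      fix h :: real assume h: "h \<noteq> 0 \<and> dist h 0 < y / 2"
      have eq: "(A - B) / h - (- D) = (A - B + h * D) / h" for A B D :: real
        using h by (simp add: field_simps)
      have "norm ((?F (y + h) - ?F y) / h - (- ?D)) = \<bar>?F (y + h) - ?F y + h * ?D\<bar> / \<bar>h\<bar>"
        unfolding eq by simp
      also have "\<dots> \<le> C * h\<^sup>2 / \<bar>h\<bar>" using bd[of h] h by (intro divide_right_mono) auto
      also have "\<dots> = C * \<bar>h\<bar>" using h by (simp add: power2_eq_square field_simps flip: abs_mult)
      finally show "norm ((?F (y + h) - ?F y) / h - (- ?D)) \<le> C * \<bar>h\<bar>" .
    qed (use y in auto)
    show "((\<lambda>h. C * \<bar>h\<bar>) \<longlongrightarrow> 0) (at 0)"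
      by (auto intro!: tendsto_eq_intros)
  qed
  then show ?thesis unfolding DERIV_def by (simp only: Lim_null[symmetric])
qed

section \<open>An integral representation of the Bessel function of the second kind\<close>

text \<open>The substitution rule for absolutely integrable functions, carried over from the
  completed Lebesgue measure to \<open>lborel\<close>. The equivalence handles integrability and
  value together, so that one application transports both.\<close>

lemma lborel_change_of_variables:
  fixes f g g' :: "real \<Rightarrow> real"
  assumes [measurable]: "f \<in> borel_measurable borel" "g' \<in> borel_measurable borel"
    and der: "\<And>x. (g has_real_derivative g' x) (at x)" and inj: "inj g" and S: "range g \<in> sets borel"
  shows "integrable lborel (\<lambda>x. \<bar>g' x\<bar> * f (g x)) \<and> (LBINT x. \<bar>g' x\<bar> * f (g x)) = b
    \<longleftrightarrow> set_integrable lborel (range g) f \<and> (LBINT x:range g. f x) = b"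
proof -
  have "continuous_on UNIV g" using der DERIV_isCont continuous_at_imp_continuous_on by blast
  then have [measurable]: "g \<in> borel_measurable borel" by (rule borel_measurable_continuous_onI)
  note [measurable] = S
  have 1: "h absolutely_integrable_on T \<and> integral T h = b \<longleftrightarrow>
      set_integrable lborel T h \<and> (LBINT x:T. h x) = b"
    if [measurable]: "h \<in> borel_measurable borel" "T \<in> sets borel" for h :: "real \<Rightarrow> real" and T
  proof -
    have "h absolutely_integrable_on T \<longleftrightarrow> set_integrable lborel T h"
      unfolding set_integrable_def by (simp add: integrable_completion)
    moreover have "integral T h = (LBINT x:T. h x)" if "set_integrable lborel T h"
      using set_borel_integral_eq_integral(2)[OF that] by simp
    ultimately show ?thesis by auto
  qed
  have "(\<lambda>x. \<bar>g' x\<bar> * f (g x)) absolutely_integrable_on UNIV \<and>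
           integral UNIV (\<lambda>x. \<bar>g' x\<bar> * f (g x)) = b
     \<longleftrightarrow> f absolutely_integrable_on (range g) \<and> integral (range g) f = b"
    by (rule has_absolute_integral_change_of_variables_1') (use der inj in auto)
  then show ?thesis
    by (subst (asm) (1 2) 1) (auto simp: set_integrable_def set_lebesgue_integral_def)
qed

section \<open>The integrals H_a: existence, derivative, reflection, limit at 0 and
  Wronskian\<close>

lemma Gamma_exp_integral:
  assumes a: "a > (0::real)"
  shows "integrable lborel (\<lambda>v. exp (a * v - exp v))" "(LBINT v. exp (a * v - exp v)) = Gamma a"
proof -
  let ?f = "\<lambda>t::real. t powr (a - 1) / exp t"
  have rng: "range exp = {0::real<..}"
    by (auto simp: image_def) (metis exp_ln)
  \<comment> \<open>Euler's integral is given on the closed half-line; the point 0 is removed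
    because the range of \<open>exp\<close> is the open one.\<close>
  have "((\<lambda>t. if t \<in> {0<..} then ?f t else 0) has_integral Gamma a) {0..}"
    by (rule has_integral_spike[of "{0}", OF _ _ Gamma_integral_real[OF a]]) auto
  then have hi: "(?f has_integral Gamma a) {0<..}"
    by (subst (asm) has_integral_restrict) auto
  then have "?f absolutely_integrable_on {0<..}"
    by (intro nonnegative_absolutely_integrable_1) (auto simp: integrable_on_def)
  then have si: "set_integrable lborel {0<..} ?f"
    unfolding set_integrable_def by (subst (asm) integrable_completion) auto
  have "(LBINT t:{0<..}. ?f t) = Gamma a"
    using set_borel_integral_eq_integral(2)[OF si] hi by (simp add: integral_unique)
  with si have *: "integrable lborel (\<lambda>x. \<bar>exp x\<bar> * ?f (exp x)) \<and> (LBINT x. \<bar>exp x\<bar> * ?f (exp x)) = Gamma a"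
    by (subst lborel_change_of_variables) (auto simp: rng intro!: injI DERIV_exp)
  have "\<bar>exp x\<bar> * ?f (exp x) = exp (a * x - exp x)" for x :: real
  proof -
    have "\<bar>exp x\<bar> * ?f (exp x) = exp x * exp ((a - 1) * x) / exp (exp x)" by (simp add: powr_def)
    also have "\<dots> = exp (a * x - exp x)"
      unfolding exp_diff exp_add[symmetric] by (simp add: algebra_simps)
    finally show ?thesis .
  qed
  with * show "integrable lborel (\<lambda>v. exp (a * v - exp v))" "(LBINT v. exp (a * v - exp v)) = Gamma a"
    by simp_all
qed

text \<open>The integral of \<open>t powr (a - 1) * exp (- t - y / t)\<close> over \<open>t > 0\<close> after the substitution
  \<open>t = exp v\<close>, which turns its symmetries into affine substitutions.\<close>

definition bessel_exp_integral :: "real \<Rightarrow> real \<Rightarrow> real" where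
  "bessel_exp_integral a y = (LBINT v. exp (a * v - exp v) * exp (- (y * exp (- v))))"

text \<open>For positive index the integrand is dominated by that of the Gamma function. Any other
  index is first raised to \<open>a + n > 0\<close>; the compensating factor
  \<open>exp (- v) ^ n\<close> is absorbed by \<open>exp (- (y * exp (- v)))\<close>.\<close>

lemma integrable_bessel_exp_integral:
  fixes a y :: real
  assumes y: "y > 0"
  shows "integrable lborel (\<lambda>v. exp (a * v - exp v) * exp (- (y * exp (- v))))"
proof -
  obtain n where n: "(- a :: real) < real n" using reals_Archimedean2 by blast
  have "integrable lborel (\<lambda>v. exp ((a + n) * v - exp v) * exp (- v) ^ n * exp (- (y * exp (- v))))"
  proof (rule integrable_power_times_exp)
    fix z :: real assume "z > 0"
    show "integrable lborel (\<lambda>v. exp ((a + n) * v - exp v) * exp (- (z * exp (- v))))"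
      by (rule Bochner_Integration.integrable_bound[OF Gamma_exp_integral(1)[of "a + n"]])
         (use n \<open>z > 0\<close> in auto)
  qed (use y in auto)
  moreover have "exp ((a + n) * v - exp v) * exp (- v) ^ n = exp (a * v - exp v)" for v :: real
    unfolding exp_of_nat_mult[symmetric] exp_add[symmetric] by (simp add: algebra_simps)
  ultimately show ?thesis by simp
qed

lemma bessel_exp_integral_has_derivative:
  assumes "y > 0"
  shows "(bessel_exp_integral a has_real_derivative - bessel_exp_integral (a - 1) y) (at y)"
proof -
  have "exp (a * v - exp v) * exp (- v) = exp ((a - 1) * v - exp v)" for v :: real
    unfolding exp_add[symmetric] by (simp add: algebra_simps)
  then show ?thesis
    using has_derivative_exp_integral[of "\<lambda>v. exp (a * v - exp v)" lborel "\<lambda>v. exp (- v)" y,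
      OF _ _ _ integrable_bessel_exp_integral] assms
    unfolding bessel_exp_integral_def[abs_def] by simp
qed

text \<open>The substitution of \<open>ln y - v\<close> for \<open>v\<close> exchanges
  \<open>exp v\<close> and \<open>y * exp (- v)\<close>, which leaves the exponent invariant apart
  from the linear term.\<close>

lemma bessel_exp_integral_minus:
  assumes y: "y > 0"
  shows "bessel_exp_integral (- a) y = y powr (- a) * bessel_exp_integral a y"
proof -
  have "bessel_exp_integral (- a) y
      = (LBINT v. exp (- a * (ln y + (-1) * v) - exp (ln y + (-1) * v)) * exp (- (y * exp (- (ln y + (-1) * v)))))"
    unfolding bessel_exp_integral_def by (subst lborel_integral_real_affine[of "-1" _ "ln y"]) auto
  also have "\<dots> = (LBINT v. y powr (- a) * (exp (a * v - exp v) * exp (- (y * exp (- v)))))"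
  proof (rule Bochner_Integration.integral_cong[OF refl])
    fix v :: real
    have "exp (ln y + (-1) * v) = y * exp (- v)" using y by (simp add: exp_add exp_diff exp_minus field_simps)
    moreover have "y * exp (- (ln y + (-1) * v)) = exp v" using y by (simp add: exp_add exp_diff exp_minus field_simps)
    ultimately show "exp (- a * (ln y + (-1) * v) - exp (ln y + (-1) * v)) * exp (- (y * exp (- (ln y + (-1) * v))))
       = y powr (- a) * (exp (a * v - exp v) * exp (- (y * exp (- v))))"
      using y unfolding powr_def by (simp only: exp_add[symmetric] if_False) (simp add: algebra_simps flip: exp_add)
  qed
  also have "\<dots> = y powr (- a) * bessel_exp_integral a y"
    unfolding bessel_exp_integral_def by simp
  finally show ?thesis .
qed

lemma bessel_exp_integral_tendsto_0:
  assumes a: "a > 0" and Y: "Y \<longlonglongrightarrow> 0" "\<And>n. Y n > 0"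
  shows "(\<lambda>n. bessel_exp_integral a (Y n)) \<longlonglongrightarrow> Gamma a"
proof -
  have "(\<lambda>n. LBINT v. exp (a * v - exp v) * exp (- (Y n * exp (- v)))) \<longlonglongrightarrow> (LBINT v. exp (a * v - exp v))"
  proof (rule integral_dominated_convergence[where w = "\<lambda>v. exp (a * v - exp v)"])
    show "AE v in lborel. (\<lambda>n. exp (a * v - exp v) * exp (- (Y n * exp (- v)))) \<longlonglongrightarrow> exp (a * v - exp v)"
      by (intro AE_I2) (auto intro!: tendsto_eq_intros Y)
    show "AE v in lborel. norm (exp (a * v - exp v) * exp (- (Y n * exp (- v)))) \<le> exp (a * v - exp v)" for n
      using Y(2)[of n] by (intro AE_I2) auto
  qed (use Gamma_exp_integral(1)[OF a] in auto)
  then show ?thesis using Gamma_exp_integral(2)[OF a] by (simp add: bessel_exp_integral_def)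
qed

text \<open>The left-hand side is the Wronskian of two solutions of the same equation. It is evaluated
  at \<open>y \<rightarrow> 0\<close>, where for \<open>0 < a < 1\<close> both integrals tend to values of the Gamma function.\<close>

lemma bessel_exp_integral_wronskian:
  assumes a: "0 < a" "a < 1" and y: "y > 0"
  shows "bessel_exp_integral a y * y powr (1 - a) * hyp01 (2 - a) y + bessel_exp_integral (1 - a) y * hyp01 (1 - a) y = 1"
proof -
  let ?f = "\<lambda>y. bessel_exp_integral a y * y powr (1 - a) * hyp01 (2 - a) y + bessel_exp_integral (1 - a) y * hyp01 (1 - a) y"
  have e: "1 - a + 1 = 2 - a" "2 - a + 1 = 3 - a" "1 - a + 2 = 3 - a" by auto
  have der: "(?f has_real_derivative 0) (at z)" if z: "z > 0" for z
  proof -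
    \<comment> \<open>The reflection turns \<open>H_(a-1)\<close> and \<open>H_(-a)\<close>, which
      arise by differentiation, back into \<open>H_(1-a)\<close> and \<open>H_a\<close>, so that the
      system of these two integrals is closed.\<close>
    have d1: "(bessel_exp_integral a has_real_derivative - (z powr (a - 1) * bessel_exp_integral (1 - a) z)) (at z)"
      using bessel_exp_integral_has_derivative[OF z, of a] bessel_exp_integral_minus[OF z, of "1 - a"] by simp
    have d2: "(bessel_exp_integral (1 - a) has_real_derivative - (z powr (- a) * bessel_exp_integral a z)) (at z)"
      using bessel_exp_integral_has_derivative[OF z, of "1 - a"] bessel_exp_integral_minus[OF z, of a] by simp
    have r: "hyp01 (1 - a) z = z * hyp01 (3 - a) z + (1 - a) * hyp01 (2 - a) z"
      using hyp01_rec[of z "1 - a"] unfolding e by simp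
    have p: "z powr (1 - a) = z powr (- a) * z" "z powr (a - 1) * z powr (1 - a) = 1"
      using z powr_add[of z "- a" 1] powr_add[of z "a - 1" "1 - a"] by simp_all
    have d3: "((\<lambda>z. z powr (1 - a)) has_real_derivative (1 - a) * z powr (- a)) (at z)"
      using z by (auto intro!: derivative_eq_intros)
    note d = DERIV_add[OF DERIV_mult[OF DERIV_mult[OF d1 d3] hyp01_has_derivative[of "2 - a" z UNIV]]
        DERIV_mult[OF d2 hyp01_has_derivative[of "1 - a" z UNIV]], unfolded e]
    show ?thesis
    proof (rule DERIV_cong[OF d])
      have "(- (z powr (a - 1) * bessel_exp_integral (1 - a) z) * z powr (1 - a)
         + (1 - a) * z powr (- a) * bessel_exp_integral a z) * hyp01 (2 - a) z
         + hyp01 (3 - a) z * (bessel_exp_integral a z * z powr (1 - a))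
         + (- (z powr (- a) * bessel_exp_integral a z) * hyp01 (1 - a) z
         + hyp01 (2 - a) z * bessel_exp_integral (1 - a) z)
         = bessel_exp_integral (1 - a) z * hyp01 (2 - a) z * (1 - z powr (a - 1) * z powr (1 - a))
         + bessel_exp_integral a z * (hyp01 (3 - a) z * z powr (1 - a) +
             z powr (- a) * ((1 - a) * hyp01 (2 - a) z - hyp01 (1 - a) z))"
        by (simp add: algebra_simps)
      also have "\<dots> = 0" unfolding p(2) unfolding p(1) r by (simp add: algebra_simps)
      finally show "(- (z powr (a - 1) * bessel_exp_integral (1 - a) z) * z powr (1 - a)
         + (1 - a) * z powr (- a) * bessel_exp_integral a z) * hyp01 (2 - a) z
         + hyp01 (3 - a) z * (bessel_exp_integral a z * z powr (1 - a))
         + (- (z powr (- a) * bessel_exp_integral a z) * hyp01 (1 - a) z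
         + hyp01 (2 - a) z * bessel_exp_integral (1 - a) z) = 0" .
    qed
  qed
  obtain c where c: "\<And>z. z \<in> {0<..} \<Longrightarrow> ?f z = c"
    using has_field_derivative_zero_constant[of "{0<..}" ?f] der
    by (meson convex_real_interval(3) greaterThan_iff has_field_derivative_at_within)
  have const: "?f z = ?f y" if z: "z > 0" for z
    using c[of z] c[of y] y z by simp
  define Y where "Y = (\<lambda>n. 1 / real (Suc n))"
  have Y: "Y \<longlonglongrightarrow> 0" "\<And>n. Y n > 0"
    unfolding Y_def using LIMSEQ_Suc[OF lim_1_over_n] by auto
  have h: "(\<lambda>n. hyp01 b (Y n)) \<longlonglongrightarrow> rGamma b" for b
    using isCont_tendsto_compose[OF DERIV_isCont[OF hyp01_has_derivative] Y(1), of b] by (simp add: hyp01_0)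
  have p: "(\<lambda>n. Y n powr (1 - a)) \<longlonglongrightarrow> 0 powr (1 - a)"
    using a Y by (intro tendsto_powr2 tendsto_const) (auto intro!: always_eventually less_imp_le)
  \<comment> \<open>The first product is killed by \<open>y powr (1 - a)\<close>, whose exponent is
    positive; the second tends to \<open>Gamma (1 - a) * rGamma (1 - a) = 1\<close>.\<close>
  have "(\<lambda>n. ?f (Y n)) \<longlonglongrightarrow> Gamma a * 0 powr (1 - a) * rGamma (2 - a) + Gamma (1 - a) * rGamma (1 - a)"
    using a by (intro tendsto_intros h p bessel_exp_integral_tendsto_0 Y) auto
  moreover have "(\<lambda>n. ?f (Y n)) = (\<lambda>n. ?f y)" using const Y(2) by blast
  ultimately have "?f y = Gamma a * 0 powr (1 - a) * rGamma (2 - a) + Gamma (1 - a) * rGamma (1 - a)"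
    by (simp add: LIMSEQ_const_iff)
  also have "Gamma (1 - a) * rGamma (1 - a) = 1"
    using a Gamma_real_pos[of "1 - a"] by (simp add: rGamma_inverse_Gamma del: Gamma_real_pos)
  finally show ?thesis by simp
qed

text \<open>The Wronskian identity for \<open>a\<close> and the one for \<open>1 - a\<close> are two
  linear equations for \<open>H_a\<close> and \<open>H_(1-a)\<close>. Eliminating
  \<open>H_(1-a)\<close> leaves the determinant evaluated in \<open>hyp01_wronskian\<close>.\<close>

lemma bessel_exp_integral_conv_hyp01:
  assumes a: "0 < a" "a < 1" and y: "y > 0"
  shows "sin (pi * a) / pi * bessel_exp_integral a y = hyp01 (1 - a) y - y powr a * hyp01 (1 + a) y"
proof -
  let ?H = "bessel_exp_integral"
  have w1: "?H a y * y powr (1 - a) * hyp01 (2 - a) y + ?H (1 - a) y * hyp01 (1 - a) y = 1"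
    by (rule bessel_exp_integral_wronskian) fact+
  have w2: "?H (1 - a) y * y powr a * hyp01 (1 + a) y + ?H a y * hyp01 a y = 1"
    using bessel_exp_integral_wronskian[of "1 - a" y] a y by simp
  have p: "y powr (1 - a) * y powr a = y" using y by (simp flip: powr_add)
  have "sin (pi * a) / pi * ?H a y =
      ?H a y * (hyp01 (1 - a) y * hyp01 a y - y powr (1 - a) * y powr a * hyp01 (2 - a) y * hyp01 (1 + a) y)"
    unfolding p hyp01_wronskian by simp
  also have "\<dots> = hyp01 (1 - a) y * (?H (1 - a) y * y powr a * hyp01 (1 + a) y + ?H a y * hyp01 a y)
     - y powr a * hyp01 (1 + a) y * (?H a y * y powr (1 - a) * hyp01 (2 - a) y + ?H (1 - a) y * hyp01 (1 - a) y)"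
    by (simp add: algebra_simps)
  also have "\<dots> = hyp01 (1 - a) y - y powr a * hyp01 (1 + a) y" unfolding w1 w2 by simp
  finally show ?thesis .
qed

text \<open>Here differentiation lowers the parameter, in contrast to \<open>hyp01\<close> alone:
  the product rule yields exactly the left-hand side of \<open>hyp01_rec\<close> times
  \<open>y powr (b - 1)\<close>.\<close>

lemma powr_hyp01_has_derivative:
  assumes y: "y > 0"
  shows "((\<lambda>y. y powr b * hyp01 (1 + b) y) has_real_derivative y powr (b - 1) * hyp01 b y) (at y)"
proof -
  have p: "y powr b = y powr (b - 1) * y" using y powr_add[of y "b - 1" 1] by simp
  have r: "hyp01 b y = y * hyp01 (b + 2) y + b * hyp01 (1 + b) y"
    using hyp01_rec[of y b] by (simp add: add_ac)
  have "((\<lambda>y. y powr b * hyp01 (1 + b) y) has_real_derivative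
     b * y powr (b - 1) * hyp01 (1 + b) y + y powr b * hyp01 (b + 2) y) (at y)"
    using y by (auto intro!: derivative_eq_intros simp: add_ac)
  then show ?thesis unfolding p r by (simp add: algebra_simps)
qed

lemma bessel_exp_integral_diff_conv_hyp01:
  assumes a: "0 < a" "a < 1" and y: "y > 0"
  shows "(-1) ^ n * sin (pi * a) / pi * bessel_exp_integral (a - n) y
     = hyp01 (1 - (a - n)) y - y powr (a - n) * hyp01 (1 + (a - n)) y"
  using y
proof (induction n arbitrary: y)
  case 0
  then show ?case using bessel_exp_integral_conv_hyp01[OF a 0] by simp
next
  case (Suc n)
  let ?L = "\<lambda>y. (-1) ^ n * sin (pi * a) / pi * bessel_exp_integral (a - n) y"
  let ?R = "\<lambda>y. hyp01 (1 - (a - n)) y - y powr (a - n) * hyp01 (1 + (a - n)) y"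
  have "(?L has_real_derivative (-1) ^ n * sin (pi * a) / pi * (- bessel_exp_integral (a - n - 1) y)) (at y)"
    by (intro DERIV_cmult bessel_exp_integral_has_derivative Suc.prems)
  moreover have "(?R has_real_derivative hyp01 (1 - (a - n) + 1) y - y powr (a - n - 1) * hyp01 (a - n) y) (at y)"
    by (intro DERIV_diff hyp01_has_derivative powr_hyp01_has_derivative Suc.prems)
  then have "(?L has_real_derivative hyp01 (1 - (a - n) + 1) y - y powr (a - n - 1) * hyp01 (a - n) y) (at y)"
    by (rule has_field_derivative_transform_within_open[where S = "{0<..}"])
       (use Suc.IH Suc.prems in auto)
  ultimately have "(-1) ^ n * sin (pi * a) / pi * (- bessel_exp_integral (a - n - 1) y)
      = hyp01 (1 - (a - n) + 1) y - y powr (a - n - 1) * hyp01 (a - n) y"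
    by (rule DERIV_unique)
  then show ?case by (simp add: algebra_simps)
qed

section \<open>The Bessel function K as a cosh integral\<close>

lemma bessel_I_conv_hyp01:
  assumes x: "x > 0"
  shows "bessel_I \<nu> x = (x / 2) powr \<nu> * hyp01 (\<nu> + 1) (x\<^sup>2 / 4)"
proof -
  have "(x / 2) powr (2 * real k + \<nu>) * rGamma (real k + \<nu> + 1) / fact k
      = (x / 2) powr \<nu> * (rGamma (real k + (\<nu> + 1)) / fact k * (x\<^sup>2 / 4) ^ k)" for k
  proof -
    have "(x / 2) powr (2 * real k + \<nu>) = (x / 2) powr \<nu> * (x / 2) powr real (2 * k)"
      unfolding powr_add[symmetric] by (simp add: add_ac)
    also have "(x / 2) powr real (2 * k) = (x\<^sup>2 / 4) ^ k"
      using x by (subst powr_realpow) (simp_all add: power_mult power_divide)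
    finally show ?thesis by (simp add: add_ac)
  qed
  then show ?thesis
    unfolding bessel_I_def hyp01_def by (simp only: suminf_mult[OF summable_hyp01])
qed

text \<open>The shift \<open>v = ln (x / 2) + u\<close> balances the two exponentials:
  \<open>exp v + x^2 / 4 * exp (- v)\<close> becomes \<open>x * cosh u\<close>.\<close>

lemma bessel_exp_integral_conv_cosh:
  assumes x: "x > 0"
  shows "integrable lborel (\<lambda>u. exp (a * u) * exp (- (x * cosh u)))"
    "(LBINT u. exp (a * u) * exp (- (x * cosh u))) = (x / 2) powr (- a) * bessel_exp_integral a (x\<^sup>2 / 4)"
proof -
  define b where "b = ln (x / 2)"
  have eq: "exp (a * u) * exp (- (x * cosh u)) = (x / 2) powr (- a) *
     (exp (a * (b + 1 * u) - exp (b + 1 * u)) * exp (- (x\<^sup>2 / 4 * exp (- (b + 1 * u)))))" for u :: real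
  proof -
    have 1: "exp (b + 1 * u) = x / 2 * exp u"
      using x by (simp add: b_def exp_add)
    have 2: "x\<^sup>2 / 4 * exp (- (b + 1 * u)) = x / 2 * exp (- u)"
      using x by (simp add: b_def exp_add exp_minus exp_diff power2_eq_square field_simps)
    have 3: "(x / 2) powr (- a) = exp (- a * b)" using x by (simp add: powr_def b_def)
    have 4: "x * cosh u = x / 2 * exp u + x / 2 * exp (- u)" by (simp add: cosh_def algebra_simps)
    show ?thesis unfolding 1 2 3 4 exp_add[symmetric] by (simp add: algebra_simps)
  qed
  let ?f = "\<lambda>v. exp (a * v - exp v) * exp (- (x\<^sup>2 / 4 * exp (- v)))"
  have i: "integrable lborel ?f"
    using x by (intro integrable_bessel_exp_integral) simp
  have "integrable lborel (\<lambda>u. ?f (b + 1 * u))"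
    using i by (rule lborel_integrable_real_affine) simp
  then show "integrable lborel (\<lambda>u. exp (a * u) * exp (- (x * cosh u)))"
    unfolding eq by (rule integrable_mult_right)
  have "bessel_exp_integral a (x\<^sup>2 / 4) = (LBINT u. ?f (b + 1 * u))"
    unfolding bessel_exp_integral_def by (subst lborel_integral_real_affine[of 1 _ b]) auto
  then show "(LBINT u. exp (a * u) * exp (- (x * cosh u))) = (x / 2) powr (- a) * bessel_exp_integral a (x\<^sup>2 / 4)"
    unfolding eq by simp
qed

lemma integrable_cosh_exp_cosh:
  fixes x \<nu> :: real
  assumes x: "x > 0"
  shows "integrable lborel (\<lambda>u. cosh (\<nu> * u) * exp (- (x * cosh u)))"
proof -
  have "integrable lborel (\<lambda>u. (exp (\<nu> * u) * exp (- (x * cosh u)) + exp (- \<nu> * u) * exp (- (x * cosh u))) / 2)"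
    by (intro integrable_divide Bochner_Integration.integrable_add bessel_exp_integral_conv_cosh x)
  then show ?thesis by (simp add: cosh_def algebra_simps add_divide_distrib)
qed

text \<open>Any positive non-integer order has the form \<open>n - a\<close>. The difference of the
  two \<open>bessel_I\<close> is then a multiple of \<open>H_(a-n)\<close>, that is of
  \<open>H\<close> with index \<open>- \<nu>\<close>. The integral runs over the whole line, hence
  the division by 2.\<close>

lemma bessel_K_conv_cosh:
  assumes a: "0 < a" "a < 1" and \<nu>: "\<nu> = real n - a" and x: "x > 0"
  shows "bessel_K \<nu> x = (LBINT u. cosh (\<nu> * u) * exp (- (x * cosh u))) / 2"
proof -
  let ?y = "x\<^sup>2 / 4" and ?E = "\<lambda>\<nu>. LBINT u. exp (\<nu> * u) * exp (- (x * cosh u))"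
  have spos: "sin (pi * a) > 0" using a by (intro sin_gt_zero) auto
  \<comment> \<open>This sign cancels the \<open>(-1) ^ n\<close> collected by the \<open>n\<close>
    differentiations.\<close>
  have s: "sin (\<nu> * pi) = - ((-1) ^ n * sin (pi * a))"
    unfolding \<nu> by (simp add: left_diff_distrib sin_diff mult.commute[of a])
  have h: "(-1) ^ n * sin (pi * a) / pi * bessel_exp_integral (- \<nu>) ?y
     = hyp01 (\<nu> + 1) ?y - ?y powr (- \<nu>) * hyp01 (- \<nu> + 1) ?y"
    using bessel_exp_integral_diff_conv_hyp01[OF a, of ?y n] x by (simp add: \<nu> add_ac algebra_simps)
  have p: "(x / 2) powr (- \<nu>) = (x / 2) powr \<nu> * ?y powr (- \<nu>)"
  proof -
    have "?y powr (- \<nu>) = ((x / 2) powr 2) powr (- \<nu>)" using x by (simp add: powr_numeral power_divide)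
    then show ?thesis using x by (simp only: powr_powr powr_add[symmetric]) simp
  qed
  have "bessel_I (- \<nu>) x - bessel_I \<nu> x
     = - ((x / 2) powr \<nu> * (hyp01 (\<nu> + 1) ?y - ?y powr (- \<nu>) * hyp01 (- \<nu> + 1) ?y))"
    unfolding bessel_I_conv_hyp01[OF x] p by (simp add: algebra_simps)
  also have "\<dots> = - ((x / 2) powr \<nu> * ((-1) ^ n * sin (pi * a) / pi * bessel_exp_integral (- \<nu>) ?y))"
    unfolding h ..
  also have "\<dots> = sin (\<nu> * pi) / pi * ?E (- \<nu>)"
    unfolding bessel_exp_integral_conv_cosh[OF x] s by simp
  finally have K: "bessel_K \<nu> x = ?E (- \<nu>) / 2"
    using spos unfolding bessel_K_def by (simp add: s)
  have refl: "?E (- \<nu>) = ?E \<nu>"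
    by (subst lborel_integral_real_affine[of "-1" _ 0]) auto
  have "(LBINT u. cosh (\<nu> * u) * exp (- (x * cosh u)))
     = (LBINT u. (exp (\<nu> * u) * exp (- (x * cosh u)) + exp (- \<nu> * u) * exp (- (x * cosh u))) / 2)"
    by (simp add: cosh_def algebra_simps add_divide_distrib)
  also have "\<dots> = (?E \<nu> + ?E (- \<nu>)) / 2"
    using Bochner_Integration.integral_add[OF bessel_exp_integral_conv_cosh(1)[OF x, of \<nu>]
      bessel_exp_integral_conv_cosh(1)[OF x, of "- \<nu>"]] by simp
  finally show ?thesis unfolding K using refl by simp
qed

section \<open>The integral of K over a half-line, as a Gaussian integral\<close>

lemma cosh_measurable [measurable]: "cosh \<in> borel_measurable (borel :: real measure)"
  by (intro borel_measurable_continuous_onI continuous_intros)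

text \<open>Dividing the integrand by \<open>cosh u\<close> produces, up to sign, an antiderivative
  in \<open>z\<close> that vanishes at infinity. The fundamental theorem for nonnegative functions
  on a half-line then takes the place of an exchange of integrals.\<close>

lemma bessel_K_tail_integral:
  assumes a: "0 < a" "a < 1" and \<nu>: "\<nu> = real n - a" and x: "x > 0"
  shows "(LBINT z:{x..}. bessel_K \<nu> z) = (LBINT u. cosh (\<nu> * u) / cosh u * exp (- (x * cosh u))) / 2"
proof -
  let ?A = "\<lambda>z. LBINT u. cosh (\<nu> * u) / cosh u * exp (- (z * cosh u))"
  let ?K = "\<lambda>z. LBINT u. cosh (\<nu> * u) * exp (- (z * cosh u))"
  have c1: "cosh u \<ge> 1" "cosh u > 0" "cosh u \<noteq> 0" for u :: real
    using cosh_real_ge_1[of u] by linarith+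
  have int: "integrable lborel (\<lambda>u. cosh (\<nu> * u) / cosh u * exp (- (z * cosh u)))" if "z > 0" for z
  proof (rule Bochner_Integration.integrable_bound[OF integrable_cosh_exp_cosh[OF that, of \<nu>]])
    show "AE u in lborel. norm (cosh (\<nu> * u) / cosh u * exp (- (z * cosh u))) \<le> norm (cosh (\<nu> * u) * exp (- (z * cosh u)))"
      using c1 by (intro AE_I2) (auto simp: abs_mult divide_le_eq intro!: mult_right_mono mult_left_le)
  qed measurable
  have der: "(?A has_real_derivative - ?K z) (at z)" if "z > 0" for z
    using has_derivative_exp_integral[of "\<lambda>u. cosh (\<nu> * u) / cosh u" lborel cosh z] int that c1
    by (simp add: less_imp_le)
  have lim: "(?A \<longlongrightarrow> 0) at_top"
  proof (rule Lim_null_comparison)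
    show "\<forall>\<^sub>F z in at_top. norm (?A z) \<le> exp (1 - z) * ?A 1"
      using eventually_ge_at_top[of 1]
    proof eventually_elim
      case (elim z)
      have "norm (?A z) = ?A z" using c1(2) by (simp add: less_imp_le)
      also have "\<dots> \<le> (LBINT u. exp (1 - z) * (cosh (\<nu> * u) / cosh u * exp (- (1 * cosh u))))"
      proof (intro integral_mono integrable_mult_right int)
        fix u :: real
        \<comment> \<open>Because \<open>cosh u >= 1\<close>, passing from parameter 1 to
          \<open>z\<close> gains the factor \<open>exp (1 - z)\<close> uniformly in
          \<open>u\<close>.\<close>
        have "(z - 1) * 1 \<le> (z - 1) * cosh u" using elim c1(1)[of u] by (intro mult_left_mono) auto
        then have "exp (- (z * cosh u)) \<le> exp (1 - z) * exp (- (1 * cosh u))"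
          unfolding exp_add[symmetric] by (simp add: algebra_simps)
        then have "cosh (\<nu> * u) / cosh u * exp (- (z * cosh u)) \<le> cosh (\<nu> * u) / cosh u * (exp (1 - z) * exp (- (1 * cosh u)))"
          using c1(2) by (intro mult_left_mono) (auto simp: less_imp_le)
        then show "cosh (\<nu> * u) / cosh u * exp (- (z * cosh u)) \<le> exp (1 - z) * (cosh (\<nu> * u) / cosh u * exp (- (1 * cosh u)))"
          by (simp only: mult_ac)
      qed (use elim in auto)
      also have "\<dots> = exp (1 - z) * ?A 1" by (rule integral_mult_right_zero)
      finally show ?case .
    qed
    have "((\<lambda>z::real. exp (1 - z)) \<longlongrightarrow> 0) at_top"
      by real_asymp
    then show "((\<lambda>z. exp (1 - z) * ?A 1) \<longlongrightarrow> 0) at_top"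
      by (rule tendsto_mult_left_zero)
  qed
  have [measurable]: "?K \<in> borel_measurable borel"
    by (rule lborel.borel_measurable_lebesgue_integral) measurable
  have K0: "?K z \<ge> 0" for z using c1(2) by (intro integral_nonneg_AE AE_I2) (auto simp: less_imp_le)
  have "(\<integral>\<^sup>+z. ennreal (?K z / 2) * indicator {x..} z \<partial>lborel) = ennreal (0 - (- ?A x / 2))"
  proof (rule nn_integral_FTC_atLeast)
    show "((\<lambda>x. - ?A x / 2) has_real_derivative ?K z / 2) (at z)" if "x \<le> z" for z
      using DERIV_cdivide[OF DERIV_minus[OF der], of z 2] that x by simp
    show "((\<lambda>x. - ?A x / 2) \<longlongrightarrow> 0) at_top"
      using tendsto_divide[OF tendsto_minus[OF lim] tendsto_const[of 2]] by simp
  qed (use K0 in auto)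
  then have "(\<integral>\<^sup>+z. ennreal (indicator {x..} z * (?K z / 2)) \<partial>lborel) = ennreal (?A x / 2)"
    by (subst nn_integral_cong[where v = "\<lambda>z. ennreal (?K z / 2) * indicator {x..} z"]) (auto simp: indicator_def)
  moreover have "?A x \<ge> 0" using c1(2) by (intro integral_nonneg_AE AE_I2) (auto simp: less_imp_le)
  ultimately have "(LBINT z:{x..}. ?K z / 2) = ?A x / 2"
    unfolding set_lebesgue_integral_def using K0
    by (subst integral_eq_nn_integral) (auto intro!: AE_I2)
  moreover have "(LBINT z:{x..}. bessel_K \<nu> z) = (LBINT z:{x..}. ?K z / 2)"
    using bessel_K_conv_cosh[OF a \<nu>] x by (intro set_lebesgue_integral_cong) auto
  ultimately show ?thesis by simp
qed

text \<open>The substitution \<open>u = 2 * arsinh w\<close> gives \<open>cosh u = 1 + 2 * w\<^sup>2\<close>.\<close>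

definition gauss_amplitude :: "real \<Rightarrow> real \<Rightarrow> real" where
  "gauss_amplitude \<nu> w = cosh (2 * \<nu> * arsinh w) / sqrt (1 + w\<^sup>2)"

text \<open>In \<open>du = 2 / sqrt (1 + w^2) dw\<close> the 2 cancels the factor 1/2 of the tail
  integral and the root belongs to \<open>gauss_amplitude\<close>. The constant term of
  \<open>cosh u = 1 + 2 * w^2\<close> splits off \<open>exp (- x)\<close>.\<close>

lemma bessel_K_tail_gauss:
  assumes a: "0 < a" "a < 1" and \<nu>: "\<nu> = real n - a" and x: "x > 0"
  shows "integrable lborel (\<lambda>w. gauss_amplitude \<nu> w / (1 + 2 * w\<^sup>2) * exp (- (x * (2 * w\<^sup>2))))"
   "(LBINT z:{x..}. bessel_K \<nu> z) = exp (- x) * (LBINT w. gauss_amplitude \<nu> w / (1 + 2 * w\<^sup>2) * exp (- (x * (2 * w\<^sup>2))))"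
proof -
  let ?f = "\<lambda>u. cosh (\<nu> * u) / cosh u * exp (- (x * cosh u))"
  let ?g = "\<lambda>w::real. 2 * arsinh w"
  have c1: "cosh u \<ge> 1" "cosh u > 0" "cosh u \<noteq> 0" for u :: real
    using cosh_real_ge_1[of u] by linarith+
  have int: "integrable lborel ?f"
  proof (rule Bochner_Integration.integrable_bound[OF integrable_cosh_exp_cosh[OF x, of \<nu>]])
    show "AE u in lborel. norm (?f u) \<le> norm (cosh (\<nu> * u) * exp (- (x * cosh u)))"
      using c1 by (intro AE_I2) (auto simp: abs_mult divide_le_eq intro!: mult_right_mono mult_left_le)
  qed measurable
  have rng: "range ?g = UNIV"
  proof -
    have "u = ?g (sinh (u / 2))" for u by (simp add: arsinh_sinh_real)
    then show ?thesis by blast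
  qed
  have der: "(?g has_real_derivative 2 / sqrt (w\<^sup>2 + 1)) (at w)" for w
    by (auto intro!: derivative_eq_intros)
  have inj: "inj ?g"
    by (rule injI) (metis mult_cancel_left sinh_arsinh_real zero_neq_numeral)
  have "integrable lborel (\<lambda>w. \<bar>2 / sqrt (w\<^sup>2 + 1)\<bar> * ?f (?g w)) \<and>
     (LBINT w. \<bar>2 / sqrt (w\<^sup>2 + 1)\<bar> * ?f (?g w)) = (LBINT u. ?f u)"
    by (subst lborel_change_of_variables[OF _ _ der inj])
       (use int in \<open>auto simp: rng set_integrable_def set_lebesgue_integral_def\<close>)
  moreover have "\<bar>2 / sqrt (w\<^sup>2 + 1)\<bar> * ?f (?g w) =
     2 * exp (- x) * (gauss_amplitude \<nu> w / (1 + 2 * w\<^sup>2) * exp (- (x * (2 * w\<^sup>2))))" for w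
  proof -
    have c: "cosh (?g w) = 1 + 2 * w\<^sup>2"
      using cosh_double[of "arsinh w"] by (simp add: cosh_square_eq)
    have e: "exp (- (x * (1 + 2 * w\<^sup>2))) = exp (- x) * exp (- (x * (2 * w\<^sup>2)))"
      unfolding exp_add[symmetric] by (simp add: algebra_simps)
    show ?thesis unfolding c e gauss_amplitude_def by (simp add: mult_ac add_ac)
  qed
  ultimately have *: "integrable lborel (\<lambda>w. 2 * exp (- x) * (gauss_amplitude \<nu> w / (1 + 2 * w\<^sup>2) * exp (- (x * (2 * w\<^sup>2)))))"
    "(LBINT w. 2 * exp (- x) * (gauss_amplitude \<nu> w / (1 + 2 * w\<^sup>2) * exp (- (x * (2 * w\<^sup>2))))) = (LBINT u. ?f u)"
    by simp_all
  show "integrable lborel (\<lambda>w. gauss_amplitude \<nu> w / (1 + 2 * w\<^sup>2) * exp (- (x * (2 * w\<^sup>2))))"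
    using *(1)[unfolded integrable_mult_right_iff] by (simp del: times_divide_eq_left)
  show "(LBINT z:{x..}. bessel_K \<nu> z) = exp (- x) * (LBINT w. gauss_amplitude \<nu> w / (1 + 2 * w\<^sup>2) * exp (- (x * (2 * w\<^sup>2))))"
    unfolding bessel_K_tail_integral[OF a \<nu> x] *(2)[symmetric] integral_mult_right_zero by simp
qed

section \<open>Taylor expansion of the amplitude and Gaussian moments\<close>

text \<open>The case \<open>k = 0\<close> is the normalisation of the normal density. Each
  derivative in \<open>y\<close> brings down one more \<open>w^2\<close>, and on the other side the
  factor that raises the argument of Gamma by one.\<close>

lemma gaussian_moment:
  assumes y: "y > 0"
  shows "integrable lborel (\<lambda>w. w ^ (2 * k) * exp (- (y * w\<^sup>2)))"
    "(LBINT w. w ^ (2 * k) * exp (- (y * w\<^sup>2))) = Gamma (real k + 1/2) * y powr (- (real k + 1/2))"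
proof -
  have base: "integrable lborel (\<lambda>w. 1 * exp (- (y * w\<^sup>2)))"
      "(LBINT w. 1 * exp (- (y * w\<^sup>2))) = Gamma (1/2) * y powr (- (1/2))" if y: "y > 0" for y :: real
  proof -
    \<comment> \<open>Chosen so that \<open>1 / (2 * \<sigma>^2) = y\<close>.\<close>
    let ?\<sigma> = "1 / sqrt (2 * y)"
    have eq: "1 * exp (- (y * w\<^sup>2)) = sqrt (pi / y) * normal_density 0 ?\<sigma> w" for w
      using y by (simp add: normal_density_def power_divide real_sqrt_divide field_simps)
    show "integrable lborel (\<lambda>w. 1 * exp (- (y * w\<^sup>2)))"
      unfolding eq using y by (intro integrable_mult_right integrable_normal_density) simp
    show "(LBINT w. 1 * exp (- (y * w\<^sup>2))) = Gamma (1/2) * y powr (- (1/2))"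
      unfolding eq using y
      by (simp add: Gamma_one_half_real powr_minus powr_half_sqrt real_sqrt_divide field_simps)
  qed
  have int: "integrable lborel (\<lambda>w. w ^ (2 * k) * exp (- (y * w\<^sup>2)))" if "y > 0" for k and y :: real
    using integrable_power_times_exp[of "\<lambda>_. 1" lborel "\<lambda>w. w\<^sup>2" y k] base(1) that
    by (simp add: power_mult)
  then show "integrable lborel (\<lambda>w. w ^ (2 * k) * exp (- (y * w\<^sup>2)))" using y by blast
  show "(LBINT w. w ^ (2 * k) * exp (- (y * w\<^sup>2))) = Gamma (real k + 1/2) * y powr (- (real k + 1/2))"
    using y
  proof (induction k arbitrary: y)
    case 0
    then show ?case using base(2) by simp
  next
    case (Suc k)
    let ?L = "\<lambda>y. LBINT w. w ^ (2 * k) * exp (- (y * w\<^sup>2))"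
    let ?R = "\<lambda>y. Gamma (real k + 1/2) * y powr (- (real k + 1/2))"
    have "(?L has_real_derivative - (LBINT w. w ^ (2 * k) * w\<^sup>2 * exp (- (y * w\<^sup>2)))) (at y)"
      by (rule has_derivative_exp_integral) (use int Suc.prems in auto)
    moreover have "(?R has_real_derivative Gamma (real k + 1/2) * (- (real k + 1/2) * y powr (- (real k + 1/2) - 1))) (at y)"
      using Suc.prems by (auto intro!: derivative_eq_intros)
    then have "(?L has_real_derivative Gamma (real k + 1/2) * (- (real k + 1/2) * y powr (- (real k + 1/2) - 1))) (at y)"
      by (rule has_field_derivative_transform_within_open[where S = "{0<..}"])
         (use Suc.IH Suc.prems in auto)
    ultimately have "- (LBINT w. w ^ (2 * k) * w\<^sup>2 * exp (- (y * w\<^sup>2)))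
        = Gamma (real k + 1/2) * (- (real k + 1/2) * y powr (- (real k + 1/2) - 1))"
      by (rule DERIV_unique)
    then have "(LBINT w. w ^ (2 * k) * w\<^sup>2 * exp (- (y * w\<^sup>2)))
        = (real k + 1/2) * Gamma (real k + 1/2) * y powr (- (real k + 1/2) - 1)"
      by (simp only: mult_minus_left mult_minus_right neg_equal_iff_equal mult_ac)
    moreover have "Gamma (real (Suc k) + 1/2) = (real k + 1/2) * Gamma (real k + 1/2)"
    proof -
      have "real k + 1/2 \<notin> \<int>\<^sub>\<le>\<^sub>0" by (auto dest: nonpos_Ints_nonpos)
      then show ?thesis using Gamma_plus1[of "real k + 1/2"] by (simp add: add_ac)
    qed
    ultimately show ?case by (simp add: power_add[symmetric] add_ac minus_add_distrib)
  qed
qed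

text \<open>The amplitude \<open>q\<close> solves \<open>(1 + w\<^sup>2) q'' + 3 w q' + (1 - 4 \<nu>\<^sup>2) q = 0\<close>; the third equation is
  the \<open>n\<close>-th derivative of this, solved for the highest derivative of \<open>q\<close>.\<close>

fun amp_deriv :: "real \<Rightarrow> nat \<Rightarrow> real \<Rightarrow> real" where
  "amp_deriv \<nu> 0 w = gauss_amplitude \<nu> w"
| "amp_deriv \<nu> (Suc 0) w = (2 * \<nu> * sinh (2 * \<nu> * arsinh w) - w * gauss_amplitude \<nu> w) / (1 + w\<^sup>2)"
| "amp_deriv \<nu> (Suc (Suc n)) w =
    - ((2 * real n + 3) * w * amp_deriv \<nu> (Suc n) w + ((real n + 1)\<^sup>2 - 4 * \<nu>\<^sup>2) * amp_deriv \<nu> n w) / (1 + w\<^sup>2)"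

lemma amp_deriv_has_derivative: "(amp_deriv \<nu> n has_real_derivative amp_deriv \<nu> (Suc n) w) (at w)"
proof (induction n arbitrary: w rule: less_induct)
  case (less n)
  have pos: "1 + w\<^sup>2 > 0" "1 + w\<^sup>2 \<noteq> 0" by (auto simp: add_pos_nonneg add_nonneg_eq_0_iff)
  \<comment> \<open>The quotient rule when the numerator is already a multiple of the denominator
    \<open>W = 1 + w^2\<close>: one factor \<open>W\<close> cancels, so the recursion keeps a single
    \<open>1 + w^2\<close> below.\<close>
  have quot: "(d * W - n * W * (2 * w)) / (W * W) = (d - n * (2 * w)) / W" if "W \<noteq> 0" for d n W :: real
    using that by (simp add: field_simps)
  define r where "r = sqrt (1 + w\<^sup>2)"
  have r: "r > 0" "r * r = 1 + w\<^sup>2" "r\<^sup>2 = 1 + w\<^sup>2" using pos by (auto simp: r_def)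
  have da: "(arsinh has_real_derivative 1 / r) (at w)"
    by (auto intro!: derivative_eq_intros simp: r_def add_ac)
  have ds: "((\<lambda>w. 1 + w\<^sup>2) has_real_derivative 2 * w) (at w)"
    by (auto intro!: derivative_eq_intros)
  have dr: "((\<lambda>w. sqrt (1 + w\<^sup>2)) has_real_derivative w / r) (at w)"
    using pos by (auto intro!: derivative_eq_intros simp: r_def field_simps)
  have dth: "((\<lambda>w. 2 * \<nu> * arsinh w) has_real_derivative 2 * \<nu> * (1 / r)) (at w)"
    by (rule DERIV_cmult[OF da])
  have dcosh: "((\<lambda>w. cosh (2 * \<nu> * arsinh w)) has_real_derivative sinh (2 * \<nu> * arsinh w) * (2 * \<nu> * (1 / r))) (at w)"
    by (rule DERIV_chain2[OF _ dth]) (auto intro!: derivative_eq_intros)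
  have dsinh: "((\<lambda>w. sinh (2 * \<nu> * arsinh w)) has_real_derivative cosh (2 * \<nu> * arsinh w) * (2 * \<nu> * (1 / r))) (at w)"
    by (rule DERIV_chain2[OF _ dth]) (auto intro!: derivative_eq_intros)
  have g: "gauss_amplitude \<nu> w = cosh (2 * \<nu> * arsinh w) / r" by (simp add: gauss_amplitude_def r_def)
  have d0: "(gauss_amplitude \<nu> has_real_derivative amp_deriv \<nu> (Suc 0) w) (at w)"
  proof -
    have "(gauss_amplitude \<nu> has_real_derivative
        (sinh (2 * \<nu> * arsinh w) * (2 * \<nu> * (1 / r)) * r - cosh (2 * \<nu> * arsinh w) * (w / r)) / (r * r)) (at w)"
      unfolding gauss_amplitude_def[abs_def]
      using DERIV_divide[OF dcosh dr] r by (simp add: r_def)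
    moreover have "(sinh (2 * \<nu> * arsinh w) * (2 * \<nu> * (1 / r)) * r - cosh (2 * \<nu> * arsinh w) * (w / r)) / (r * r)
       = amp_deriv \<nu> (Suc 0) w"
      using r(1) unfolding amp_deriv.simps g r(2)[symmetric] by (simp add: field_simps)
    ultimately show ?thesis by simp
  qed
  consider "n = 0" | "n = 1" | m where "n = Suc (Suc m)" by (metis One_nat_def not0_implies_Suc)
  then show ?case
  proof cases
    case 1
    then show ?thesis using d0 by (simp add: amp_deriv.simps(1)[abs_def] del: amp_deriv.simps(2))
  next
    case 2
    let ?D = "(2 * \<nu> * (cosh (2 * \<nu> * arsinh w) * (2 * \<nu> * (1 / r))) - (1 * gauss_amplitude \<nu> w + amp_deriv \<nu> 1 w * w))"
    let ?N = "2 * \<nu> * sinh (2 * \<nu> * arsinh w) - w * gauss_amplitude \<nu> w"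
    have "(amp_deriv \<nu> 1 has_real_derivative (?D * (1 + w\<^sup>2) - ?N * (2 * w)) / ((1 + w\<^sup>2) * (1 + w\<^sup>2))) (at w)"
      using DERIV_divide[OF DERIV_diff[OF DERIV_cmult[OF dsinh, of "2 * \<nu>"] DERIV_mult[OF DERIV_ident d0]] ds] pos(2)
      by (simp add: amp_deriv.simps(2)[abs_def] del: amp_deriv.simps(2))
    moreover have "(?D * (1 + w\<^sup>2) - ?N * (2 * w)) / ((1 + w\<^sup>2) * (1 + w\<^sup>2)) = amp_deriv \<nu> 2 w"
    proof -
      have N: "?N = amp_deriv \<nu> 1 w * (1 + w\<^sup>2)" using pos by simp
      have D: "?D = 4 * \<nu>\<^sup>2 * gauss_amplitude \<nu> w - gauss_amplitude \<nu> w - amp_deriv \<nu> 1 w * w"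
        unfolding g by (simp add: power2_eq_square)
      have "(?D * (1 + w\<^sup>2) - ?N * (2 * w)) / ((1 + w\<^sup>2) * (1 + w\<^sup>2)) = (?D - amp_deriv \<nu> 1 w * (2 * w)) / (1 + w\<^sup>2)"
        unfolding N by (rule quot[OF pos(2)])
      also have "\<dots> = amp_deriv \<nu> 2 w"
        unfolding D by (simp add: numeral_2_eq_2 algebra_simps del: amp_deriv.simps(2))
      finally show ?thesis .
    qed
    ultimately have "(amp_deriv \<nu> 1 has_real_derivative amp_deriv \<nu> 2 w) (at w)"
      by (rule DERIV_cong)
    then show ?thesis by (simp only: 2 numeral_2_eq_2 One_nat_def)
  next
    case 3
    let ?N = "\<lambda>w. - ((2 * real m + 3) * w * amp_deriv \<nu> (Suc m) w + ((real m + 1)\<^sup>2 - 4 * \<nu>\<^sup>2) * amp_deriv \<nu> m w)"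
    let ?D = "- ((2 * real m + 3) * amp_deriv \<nu> (Suc m) w + amp_deriv \<nu> n w * ((2 * real m + 3) * w)
        + ((real m + 1)\<^sup>2 - 4 * \<nu>\<^sup>2) * amp_deriv \<nu> (Suc m) w)"
    have i1: "(amp_deriv \<nu> m has_real_derivative amp_deriv \<nu> (Suc m) w) (at w)"
      by (rule less) (simp add: 3)
    have i2: "(amp_deriv \<nu> (Suc m) has_real_derivative amp_deriv \<nu> n w) (at w)"
      using less[of "Suc m" w] 3 by simp
    have dN: "(?N has_real_derivative ?D) (at w)"
      by (rule DERIV_cong[OF DERIV_minus[OF DERIV_add[OF DERIV_mult[OF DERIV_cmult[OF DERIV_ident, of "2 * real m + 3"] i2] DERIV_cmult[OF i1]]]]) simp
    have "(amp_deriv \<nu> n has_real_derivative (?D * (1 + w\<^sup>2) - ?N w * (2 * w)) / ((1 + w\<^sup>2) * (1 + w\<^sup>2))) (at w)"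
      using DERIV_divide[OF dN ds] pos(2) unfolding 3 by (simp add: amp_deriv.simps(3)[abs_def] del: amp_deriv.simps)
    moreover have "(?D * (1 + w\<^sup>2) - ?N w * (2 * w)) / ((1 + w\<^sup>2) * (1 + w\<^sup>2)) = amp_deriv \<nu> (Suc n) w"
    proof -
      have N: "?N w = amp_deriv \<nu> n w * (1 + w\<^sup>2)" using pos by (simp add: 3 del: amp_deriv.simps(1,2))
      have "(?D * (1 + w\<^sup>2) - ?N w * (2 * w)) / ((1 + w\<^sup>2) * (1 + w\<^sup>2)) = (?D - amp_deriv \<nu> n w * (2 * w)) / (1 + w\<^sup>2)"
        unfolding N by (rule quot[OF pos(2)])
      \<comment> \<open>The coefficients advance by \<open>(2 * m + 3) + 2 = 2 * (m + 1) + 3\<close>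
        and \<open>(m + 1)^2 + (2 * m + 3) = (m + 2)^2\<close>.\<close>
      also have "?D - amp_deriv \<nu> n w * (2 * w) =
          - ((2 * real (Suc m) + 3) * w * amp_deriv \<nu> n w + ((real (Suc m) + 1)\<^sup>2 - 4 * \<nu>\<^sup>2) * amp_deriv \<nu> (Suc m) w)"
        by (simp add: algebra_simps power2_eq_square del: amp_deriv.simps)
      also have "\<dots> / (1 + w\<^sup>2) = amp_deriv \<nu> (Suc n) w"
        using amp_deriv.simps(3)[of \<nu> "Suc m" w] unfolding 3 by simp
      finally show ?thesis .
    qed
    ultimately show ?thesis by simp
  qed
qed

text \<open>These are the coefficients in \<open>w^2\<close> of the hypergeometric function 2F1(1/2
  - nu, 1/2 + nu; 1/2; -w^2).\<close>

definition amp_coeff :: "real \<Rightarrow> nat \<Rightarrow> real" where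
  "amp_coeff \<nu> m = (-1) ^ m * pochhammer (1/2 - \<nu>) m * pochhammer (1/2 + \<nu>) m / (fact m * pochhammer (1/2) m)"

text \<open>At \<open>w = 0\<close> the middle term of the recursion disappears and it becomes a
  two-step recursion: odd derivatives inherit the zero of the first one, even ones multiply up to
  Pochhammer symbols.\<close>

lemma amp_deriv_0:
  "amp_deriv \<nu> (2 * m) 0 / fact (2 * m) = amp_coeff \<nu> m"
  "amp_deriv \<nu> (2 * m + 1) 0 = 0"
proof -
  show "amp_deriv \<nu> (2 * m + 1) 0 = 0" by (induction m) auto
  show "amp_deriv \<nu> (2 * m) 0 / fact (2 * m) = amp_coeff \<nu> m"
  proof (induction m)
    case 0
    then show ?case by (simp add: amp_coeff_def gauss_amplitude_def)
  next
    case (Suc m)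
    have p: "pochhammer (1/2 :: real) m > 0" by (intro pochhammer_pos) simp
    have "amp_deriv \<nu> (2 * Suc m) 0 / fact (2 * Suc m)
       = (4 * \<nu>\<^sup>2 - (2 * real m + 1)\<^sup>2) / ((2 * real m + 2) * (2 * real m + 1)) * (amp_deriv \<nu> (2 * m) 0 / fact (2 * m))"
      by (simp add: divide_simps) (simp add: algebra_simps)
    also have "\<dots> = (4 * \<nu>\<^sup>2 - (2 * real m + 1)\<^sup>2) / ((2 * real m + 2) * (2 * real m + 1)) * amp_coeff \<nu> m"
      unfolding Suc ..
    also have "\<dots> = amp_coeff \<nu> (Suc m)"
    proof -
      have "(4 * \<nu>\<^sup>2 - (2 * real m + 1)\<^sup>2) = - 4 * ((1/2 - \<nu> + real m) * (1/2 + \<nu> + real m))"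
        by (simp add: algebra_simps power2_eq_square)
      moreover have "(2 * real m + 2) * (2 * real m + 1) = 4 * ((real m + 1) * (1/2 + real m))"
        by (simp add: algebra_simps)
      ultimately have "(4 * \<nu>\<^sup>2 - (2 * real m + 1)\<^sup>2) / ((2 * real m + 2) * (2 * real m + 1))
          = - ((1/2 - \<nu> + real m) * (1/2 + \<nu> + real m)) / ((real m + 1) * (1/2 + real m))"
        by (simp only:) simp
      then show ?thesis
        unfolding amp_coeff_def pochhammer_Suc by (simp only:) (simp add: mult_ac add_ac)
    qed
    finally show ?case .
  qed
qed

section \<open>Taylor remainders of the amplitude and of its quotient by 1 + 2 w^2\<close>

lemma sum_even_odd: "(\<Sum>k<2 * n. f k) = (\<Sum>m<n. f (2 * m) + f (2 * m + 1))" for f :: "nat \<Rightarrow> 'a::comm_monoid_add"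
  by (induction n) (auto simp: add_ac)

text \<open>Maclaurin's formula with \<open>2 * Suc N\<close> terms, of which only the even ones
  survive. The derivative in the remainder is bounded on the compact interval from -1 to 1.\<close>

lemma gauss_amplitude_taylor:
  obtains C where "C \<ge> 0" "\<And>w. \<bar>w\<bar> \<le> 1 \<Longrightarrow>
    \<bar>gauss_amplitude \<nu> w - (\<Sum>m\<le>N. amp_coeff \<nu> m * w ^ (2 * m))\<bar> \<le> C * w ^ (2 * Suc N)"
proof -
  let ?n = "2 * Suc N"
  have "continuous_on {-1..1} (amp_deriv \<nu> ?n)"
    using amp_deriv_has_derivative DERIV_isCont continuous_at_imp_continuous_on by blast
  then have "bounded (amp_deriv \<nu> ?n ` {-1..1})"
    by (intro compact_imp_bounded compact_continuous_image) auto
  then obtain B where B: "\<And>t. t \<in> {-1..1} \<Longrightarrow> \<bar>amp_deriv \<nu> ?n t\<bar> \<le> B"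
    unfolding bounded_iff real_norm_def by blast
  show ?thesis
  proof (rule that[of "\<bar>B\<bar>"])
    fix w :: real assume w: "\<bar>w\<bar> \<le> 1"
    have wn: "w ^ ?n \<ge> 0" by (simp only: zero_le_even_power dvd_triv_left)
    obtain t where t: "\<bar>t\<bar> \<le> \<bar>w\<bar>" "gauss_amplitude \<nu> w
        = (\<Sum>k<?n. (amp_deriv \<nu> k 0 / fact k) * w ^ k) + (amp_deriv \<nu> ?n t / fact ?n) * w ^ ?n"
      using Maclaurin_all_le[of "amp_deriv \<nu>" "gauss_amplitude \<nu>" w ?n] amp_deriv_has_derivative
      by (auto simp: amp_deriv.simps(1)[abs_def] simp del: amp_deriv.simps)
    have "(\<Sum>k<?n. (amp_deriv \<nu> k 0 / fact k) * w ^ k) = (\<Sum>m\<le>N. amp_coeff \<nu> m * w ^ (2 * m))"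
      unfolding sum_even_odd amp_deriv_0 lessThan_Suc_atMost by simp
    with t(2) have "\<bar>gauss_amplitude \<nu> w - (\<Sum>m\<le>N. amp_coeff \<nu> m * w ^ (2 * m))\<bar>
        = \<bar>(amp_deriv \<nu> ?n t / fact ?n) * w ^ ?n\<bar>" by simp
    also have "\<dots> = \<bar>amp_deriv \<nu> ?n t\<bar> / fact ?n * w ^ ?n"
      by (simp only: abs_mult abs_divide abs_of_nonneg[OF wn] abs_of_nonneg[OF fact_ge_zero])
    also have "\<dots> \<le> \<bar>B\<bar> * w ^ ?n"
    proof (rule mult_right_mono)
      have "\<bar>amp_deriv \<nu> ?n t\<bar> / fact ?n \<le> \<bar>amp_deriv \<nu> ?n t\<bar> / 1"
        by (intro divide_left_mono fact_ge_1) (auto simp del: fact_Suc)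
      also have "\<dots> \<le> \<bar>B\<bar>"
      proof -
        have "t \<in> {-1..1}" using t(1) w by auto
        from B[OF this] show ?thesis by linarith
      qed
      finally show "\<bar>amp_deriv \<nu> ?n t\<bar> / fact ?n \<le> \<bar>B\<bar>" .
    qed (rule wn)
    finally show "\<bar>gauss_amplitude \<nu> w - (\<Sum>m\<le>N. amp_coeff \<nu> m * w ^ (2 * m))\<bar> \<le> \<bar>B\<bar> * w ^ ?n" .
  qed simp
qed

text \<open>The product of the Taylor polynomial \<open>P\<close> and the geometric sum
  \<open>G\<close> is kept whole, up to the power \<open>4 * N\<close> of \<open>w\<close>, to match
  a double sum in which both indices run to \<open>N\<close>. Multiplying by
  \<open>1 + 2 * w^2 >= 1\<close> reduces the error to the two separate remainders.\<close>

lemma gauss_amplitude_quotient_taylor: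
  obtains C where "\<And>w. \<bar>w\<bar> \<le> 1 \<Longrightarrow>
    \<bar>gauss_amplitude \<nu> w / (1 + 2 * w\<^sup>2)
      - (\<Sum>n\<le>N. \<Sum>m\<le>N. amp_coeff \<nu> m * (-2) ^ n * w ^ (2 * (m + n)))\<bar> \<le> C * w ^ (2 * Suc N)"
proof -
  obtain C where C: "C \<ge> 0" "\<And>w. \<bar>w\<bar> \<le> 1 \<Longrightarrow>
    \<bar>gauss_amplitude \<nu> w - (\<Sum>m\<le>N. amp_coeff \<nu> m * w ^ (2 * m))\<bar> \<le> C * w ^ (2 * Suc N)"
    using gauss_amplitude_taylor by blast
  let ?B = "\<Sum>m\<le>N. \<bar>amp_coeff \<nu> m\<bar>"
  show ?thesis
  proof (rule that[of "C + ?B * 2 ^ Suc N"])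
    fix w :: real assume w: "\<bar>w\<bar> \<le> 1"
    define P where "P = (\<Sum>m\<le>N. amp_coeff \<nu> m * w ^ (2 * m))"
    define G where "G = (\<Sum>n\<le>N. (- 2 * w\<^sup>2) ^ n)"
    have pos: "1 + 2 * w\<^sup>2 \<ge> 1" by simp
    then have ne: "1 + 2 * w\<^sup>2 \<noteq> 0" by linarith
    have we: "w ^ (2 * Suc N) \<ge> 0" by (simp only: zero_le_even_power dvd_triv_left)
    have PG: "(\<Sum>n\<le>N. \<Sum>m\<le>N. amp_coeff \<nu> m * (-2) ^ n * w ^ (2 * (m + n))) = P * G"
    proof -
      have "amp_coeff \<nu> m * (-2) ^ n * w ^ (2 * (m + n)) = amp_coeff \<nu> m * w ^ (2 * m) * (- 2 * w\<^sup>2) ^ n" for m n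
        by (simp only: power_mult_distrib distrib_left power_add power_mult) simp
      then show ?thesis unfolding P_def G_def
        by (simp only: sum_product) (rule sum.swap)
    qed
    have G: "(1 + 2 * w\<^sup>2) * G = 1 - (- 2 * w\<^sup>2) ^ Suc N"
      using one_diff_power_eq[of "- 2 * w\<^sup>2" "Suc N"] unfolding G_def lessThan_Suc_atMost[symmetric] by simp
    have "gauss_amplitude \<nu> w / (1 + 2 * w\<^sup>2) - P * G
        = (gauss_amplitude \<nu> w - P * ((1 + 2 * w\<^sup>2) * G)) / (1 + 2 * w\<^sup>2)"
      using ne by (simp add: diff_divide_distrib)
    also have "\<dots> = ((gauss_amplitude \<nu> w - P) + P * (- 2 * w\<^sup>2) ^ Suc N) / (1 + 2 * w\<^sup>2)"
      unfolding G by (simp only: right_diff_distrib) simp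
    finally have "\<bar>gauss_amplitude \<nu> w / (1 + 2 * w\<^sup>2) - P * G\<bar>
        = \<bar>(gauss_amplitude \<nu> w - P) + P * (- 2 * w\<^sup>2) ^ Suc N\<bar> / \<bar>1 + 2 * w\<^sup>2\<bar>"
      by (simp only: abs_divide)
    also have "\<dots> \<le> \<bar>(gauss_amplitude \<nu> w - P) + P * (- 2 * w\<^sup>2) ^ Suc N\<bar>"
      using divide_left_mono[of 1 "\<bar>1 + 2 * w\<^sup>2\<bar>" "\<bar>(gauss_amplitude \<nu> w - P) + P * (- 2 * w\<^sup>2) ^ Suc N\<bar>"] pos
      by simp
    also have "\<dots> \<le> \<bar>gauss_amplitude \<nu> w - P\<bar> + \<bar>P\<bar> * \<bar>(- 2 * w\<^sup>2) ^ Suc N\<bar>"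
      unfolding abs_mult[symmetric] by (rule abs_triangle_ineq)
    also have "\<dots> \<le> C * w ^ (2 * Suc N) + ?B * (2 ^ Suc N * w ^ (2 * Suc N))"
    proof (intro add_mono mult_mono)
      show "\<bar>gauss_amplitude \<nu> w - P\<bar> \<le> C * w ^ (2 * Suc N)" using C(2)[OF w] unfolding P_def .
      have "\<bar>P\<bar> \<le> (\<Sum>m\<le>N. \<bar>amp_coeff \<nu> m * w ^ (2 * m)\<bar>)" unfolding P_def by (rule sum_abs)
      also have "\<dots> \<le> ?B"
        using w by (intro sum_mono) (auto simp: abs_mult power_abs intro!: mult_left_le power_le_one)
      finally show "\<bar>P\<bar> \<le> ?B" .
      show "\<bar>(- 2 * w\<^sup>2) ^ Suc N\<bar> \<le> 2 ^ Suc N * w ^ (2 * Suc N)"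
        by (simp only: power_abs abs_mult power_mult_distrib power_mult) simp
    qed (auto intro: sum_nonneg)
    finally show "\<bar>gauss_amplitude \<nu> w / (1 + 2 * w\<^sup>2)
      - (\<Sum>n\<le>N. \<Sum>m\<le>N. amp_coeff \<nu> m * (-2) ^ n * w ^ (2 * (m + n)))\<bar> \<le> (C + ?B * 2 ^ Suc N) * w ^ (2 * Suc N)"
      unfolding PG by (simp only: distrib_right mult.assoc)
  qed
qed

section \<open>The asymptotic expansion\<close>

lemma powr_minus_add_half: "x powr (- (real k + 1/2)) = 1 / (x ^ k * sqrt x)" if "x > 0" for x :: real
proof -
  have "x powr (real k + 1/2) = x ^ k * sqrt x"
    using that by (simp add: powr_add powr_realpow powr_half_sqrt)
  then show ?thesis by (simp only: powr_minus inverse_eq_divide)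
qed

text \<open>The error estimate of Watson's lemma: near 0 the power bound is integrated against the
  Gaussian, and the rest is exponentially small in \<open>x\<close>.\<close>

lemma gaussian_integral_bound:
  fixes E :: "real \<Rightarrow> real"
  assumes E: "\<And>w. \<bar>w\<bar> \<le> 1 \<Longrightarrow> \<bar>E w\<bar> \<le> C * w ^ (2 * M)"
    and int: "integrable lborel (\<lambda>w. E w * exp (- (2 * w\<^sup>2)))"
  obtains K where "\<And>x. x \<ge> 1 \<Longrightarrow>
    \<bar>LBINT w. E w * exp (- (x * (2 * w\<^sup>2)))\<bar> \<le> K * x powr (- (real M + 1/2))"
proof -
  define I where "I = (LBINT w. \<bar>E w * exp (- (2 * w\<^sup>2))\<bar>)"
  have I: "I \<ge> 0" unfolding I_def by (intro integral_nonneg_AE AE_I2) auto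
  define K1 where "K1 = \<bar>C\<bar> * (Gamma (real M + 1/2) * 2 powr (- (real M + 1/2)))"
  show ?thesis
  proof (rule that[of "K1 + exp 2 * fact (Suc M) * I"])
    fix x :: real assume x: "x \<ge> 1"
    have im: "integrable lborel (\<lambda>w. \<bar>C\<bar> * (w ^ (2 * M) * exp (- (2 * x * w\<^sup>2))))"
      using x by (intro integrable_mult_right gaussian_moment) auto
    have ii: "integrable lborel (\<lambda>w. exp (2 - 2 * x) * \<bar>E w * exp (- (2 * w\<^sup>2))\<bar>)"
      using int by (intro integrable_mult_right integrable_abs)
    have "\<bar>LBINT w. E w * exp (- (x * (2 * w\<^sup>2)))\<bar> \<le> (LBINT w. \<bar>E w * exp (- (x * (2 * w\<^sup>2)))\<bar>)"
      by (rule integral_abs_bound)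
    \<comment> \<open>Both bounds are nonnegative, so their sum majorises the integrand on the whole
      line and the integral need not be split.\<close>
    also have "\<dots> \<le> (LBINT w. \<bar>C\<bar> * (w ^ (2 * M) * exp (- (2 * x * w\<^sup>2)))
        + exp (2 - 2 * x) * \<bar>E w * exp (- (2 * w\<^sup>2))\<bar>)"
    proof (rule integral_mono')
      fix w :: real
      have nn: "w ^ (2 * M) \<ge> 0" by (simp add: power_mult)
      then have nn1: "\<bar>C\<bar> * (w ^ (2 * M) * exp (- (2 * x * w\<^sup>2))) \<ge> 0" by simp
      have nn2: "exp (2 - 2 * x) * \<bar>E w * exp (- (2 * w\<^sup>2))\<bar> \<ge> 0" by simp
      show "\<bar>C\<bar> * (w ^ (2 * M) * exp (- (2 * x * w\<^sup>2))) + exp (2 - 2 * x) * \<bar>E w * exp (- (2 * w\<^sup>2))\<bar> \<ge> 0"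
        using nn1 nn2 by simp
      show "\<bar>E w * exp (- (x * (2 * w\<^sup>2)))\<bar> \<le> \<bar>C\<bar> * (w ^ (2 * M) * exp (- (2 * x * w\<^sup>2)))
          + exp (2 - 2 * x) * \<bar>E w * exp (- (2 * w\<^sup>2))\<bar>"
      proof (cases "\<bar>w\<bar> \<le> 1")
        case True
        have "\<bar>E w\<bar> \<le> \<bar>C\<bar> * w ^ (2 * M)"
          using E[OF True] mult_right_mono[OF abs_ge_self[of C] nn] by linarith
        then have "\<bar>E w\<bar> * exp (- (2 * x * w\<^sup>2)) \<le> \<bar>C\<bar> * w ^ (2 * M) * exp (- (2 * x * w\<^sup>2))"
          by (rule mult_right_mono) simp
        moreover have "\<bar>E w * exp (- (x * (2 * w\<^sup>2)))\<bar> = \<bar>E w\<bar> * exp (- (2 * x * w\<^sup>2))"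
          by (simp add: abs_mult mult_ac)
        ultimately show ?thesis using nn2 unfolding mult.assoc by linarith
      next
        case False
        \<comment> \<open>Here \<open>2 * x * w^2 >= 2 * w^2 + 2 * x - 2\<close>, which extracts
          \<open>exp (2 - 2 * x)\<close> and leaves the integrand for \<open>x = 1\<close>.\<close>
        then have "1 \<le> w\<^sup>2" using one_le_power[of "\<bar>w\<bar>" 2] by simp
        then have "(x - 1) * 1 \<le> (x - 1) * w\<^sup>2" using x by (intro mult_left_mono) auto
        then have "exp (- (x * (2 * w\<^sup>2))) \<le> exp (2 - 2 * x) * exp (- (2 * w\<^sup>2))"
          unfolding exp_add[symmetric] by (simp add: algebra_simps)
        then have "\<bar>E w\<bar> * exp (- (x * (2 * w\<^sup>2))) \<le> \<bar>E w\<bar> * (exp (2 - 2 * x) * exp (- (2 * w\<^sup>2)))"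
          by (rule mult_left_mono) simp
        moreover have "\<bar>E w\<bar> * (exp (2 - 2 * x) * exp (- (2 * w\<^sup>2))) = exp (2 - 2 * x) * \<bar>E w * exp (- (2 * w\<^sup>2))\<bar>"
          by (simp add: abs_mult)
        moreover have "\<bar>E w * exp (- (x * (2 * w\<^sup>2)))\<bar> = \<bar>E w\<bar> * exp (- (x * (2 * w\<^sup>2)))"
          by (simp add: abs_mult)
        ultimately show ?thesis using nn1 by linarith
      qed
    qed (use im ii in auto)
    also have "\<dots> = \<bar>C\<bar> * (LBINT w. w ^ (2 * M) * exp (- (2 * x * w\<^sup>2))) + exp (2 - 2 * x) * I"
      unfolding I_def using im ii by (subst Bochner_Integration.integral_add) (auto simp only: integral_mult_right_zero)
    also have "(LBINT w. w ^ (2 * M) * exp (- (2 * x * w\<^sup>2)))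
        = Gamma (real M + 1/2) * 2 powr (- (real M + 1/2)) * x powr (- (real M + 1/2))"
      using x by (subst gaussian_moment(2)) (auto simp: powr_mult)
    also have "\<bar>C\<bar> * (Gamma (real M + 1/2) * 2 powr (- (real M + 1/2)) * x powr (- (real M + 1/2))) + exp (2 - 2 * x) * I
      \<le> \<bar>C\<bar> * (Gamma (real M + 1/2) * 2 powr (- (real M + 1/2)) * x powr (- (real M + 1/2)))
        + exp 2 * fact (Suc M) * x powr (- (real M + 1/2)) * I"
    proof (rule add_left_mono, rule mult_right_mono[OF _ I])
      have p: "x powr (real M + 1/2) > 0" using x by simp
      \<comment> \<open>For \<open>x >= 1\<close> the exponent may be rounded up to the integer
        \<open>M + 1\<close>, where the factorial bound applies.\<close>
      have "x powr (real M + 1/2) \<le> x powr real (Suc M)" using x by (intro powr_mono) auto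
      also have "\<dots> = x ^ Suc M" using x by (subst powr_realpow) auto
      finally have "exp (- x) * x powr (real M + 1/2) \<le> exp (- x) * x ^ Suc M" by simp
      also have "\<dots> \<le> fact (Suc M)" using power_times_exp_le[of x "Suc M"] x by (simp add: mult.commute)
      finally have "exp (- x) * x powr (real M + 1/2) \<le> fact (Suc M)" .
      then have 1: "exp (- x) \<le> fact (Suc M) * x powr (- (real M + 1/2))"
        using p by (simp only: powr_minus pos_le_divide_eq[symmetric] divide_inverse[symmetric])
      have "exp (2 - 2 * x) \<le> exp 2 * exp (- x)" unfolding exp_add[symmetric] using x by simp
      also have "\<dots> \<le> exp 2 * (fact (Suc M) * x powr (- (real M + 1/2)))"
        using 1 by (intro mult_left_mono) auto
      finally show "exp (2 - 2 * x) \<le> exp 2 * fact (Suc M) * x powr (- (real M + 1/2))" by (simp only: mult.assoc)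
    qed
    finally show "\<bar>LBINT w. E w * exp (- (x * (2 * w\<^sup>2)))\<bar>
        \<le> (K1 + exp 2 * fact (Suc M) * I) * x powr (- (real M + 1/2))"
      unfolding K1_def distrib_right by (simp only: mult_ac)
  qed
qed

section \<open>Matching the coefficients of the double sum\<close>

lemma Gamma_shift:
  assumes "z \<notin> \<int>\<^sub>\<le>\<^sub>0"
  shows "Gamma (z + real m) = pochhammer z m * Gamma (z :: real)"
  using pochhammer_Gamma[OF assms, of m] assms by (simp add: Gamma_eq_zero_iff)

text \<open>The reflection formula at \<open>a = - 7/6\<close>, for which
  \<open>1 - a = 13/6\<close> and the sine equals 1/2.\<close>

lemma Gamma_product_synchrotron: "Gamma (- (7/6)) * Gamma (13/6) = 2 * (pi :: real)"
proof -
  have "sin (pi * (- (7/6))) = - sin (pi / 6 + pi)" unfolding sin_minus[symmetric] by (simp add: algebra_simps)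
  then have s: "sin (pi * (- (7/6))) = 1/2" unfolding sin_periodic_pi sin_30 by simp
  have "rGamma (- (7/6)) * rGamma (13/6 :: real) = 1 / (2 * pi)"
    using rGamma_reflection_real[of "- (7/6)"] unfolding s by simp
  then have "inverse (rGamma (- (7/6)) * rGamma (13/6 :: real)) = 2 * pi" by simp
  then show ?thesis by (simp add: Gamma_def)
qed

text \<open>Shifting every Gamma function to its value at \<open>m = n = 0\<close> leaves Pochhammer
  symbols with the arguments \<open>- 7/6 = 1/2 - 5/3\<close> and \<open>13/6 = 1/2 + 5/3\<close> of
  \<open>amp_coeff (5/3)\<close>.\<close>

lemma synchrotron_coefficient:
  "Gamma (1/2 + real n + real m) * Gamma (- (7/6) + real m) * Gamma (13/6 + real m)
     / (2 powr (3/2 + real m) * fact m * Gamma (1/2 + real m))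
   = pi / sqrt 2 * (pochhammer (1/2 + real m) n * pochhammer (- (7/6)) m * pochhammer (13/6) m / (2 ^ m * fact m))"
proof -
  have ni: "- (7/6) \<notin> (\<int>\<^sub>\<le>\<^sub>0 :: real set)" "13/6 \<notin> (\<int>\<^sub>\<le>\<^sub>0 :: real set)" "1/2 + real m \<notin> \<int>\<^sub>\<le>\<^sub>0"
  proof -
    have "- (7/6) \<notin> (\<int> :: real set)"
    proof
      assume "- (7/6) \<in> (\<int> :: real set)"
      then obtain k :: int where "- (7/6) = real_of_int k" by (auto elim: Ints_cases)
      then have "real_of_int (6 * k) = real_of_int (- 7)" by simp
      then have "6 * k = - 7" by (simp only: of_int_eq_iff)
      then show False by presburger
    qed
    then show "- (7/6) \<notin> (\<int>\<^sub>\<le>\<^sub>0 :: real set)" using nonpos_Ints_Int by blast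
  qed (auto dest: nonpos_Ints_nonpos)
  define g where "g = Gamma (1/2 + real m)"
  have "g > 0" unfolding g_def by (intro Gamma_real_pos) simp
  then have g: "g \<noteq> 0" by simp
  have p: "2 powr (3/2 + real m) = 2 * sqrt 2 * 2 ^ m"
  proof -
    have "2 powr (3/2 + real m) = 2 powr (1 + 1/2 + real m)" by simp
    also have "\<dots> = 2 * sqrt 2 * 2 ^ m" unfolding powr_add by (simp add: powr_half_sqrt powr_realpow)
    finally show ?thesis .
  qed
  have "Gamma (1/2 + real n + real m) = pochhammer (1/2 + real m) n * g"
    using Gamma_shift[OF ni(3), of n] unfolding g_def by (simp add: add_ac)
  moreover have "Gamma (- (7/6) + real m) * Gamma (13/6 + real m)
      = pochhammer (- (7/6)) m * pochhammer (13/6) m * (2 * pi)"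
    unfolding Gamma_shift[OF ni(1)] Gamma_shift[OF ni(2)] Gamma_product_synchrotron[symmetric] by simp
  ultimately show ?thesis unfolding p g_def[symmetric] mult.assoc
    by (simp only:) (simp add: g mult_ac)
qed

text \<open>One term of the double sum: the moment contributes \<open>pochhammer (1/2) m\<close>,
  which cancels against \<open>amp_coeff\<close>, and \<open>2 ^ n\<close>, which cancels against
  \<open>(-2) ^ n\<close>. The remaining signs join the powers of \<open>1 / x\<close>.\<close>

lemma amp_coeff_moment:
  assumes x: "x > 0"
  shows "sqrt (pi * x) * (amp_coeff (5/3) m * (-2) ^ n *
      (Gamma (real (m + n) + 1/2) * (2 * x) powr (- (real (m + n) + 1/2))))
   = pi / sqrt 2 * (pochhammer (1/2 + real m) n * pochhammer (- (7/6)) m * pochhammer (13/6) m / (2 ^ m * fact m))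
      * (- (1 / x)) ^ m * (- (1 / x)) ^ n"
proof -
  have ph: "pochhammer (1/2 :: real) m > 0" by (intro pochhammer_pos) simp
  have G: "Gamma (real (m + n) + 1/2) = pochhammer (1/2) m * pochhammer (1/2 + real m) n * sqrt pi"
  proof -
    have "1/2 \<notin> (\<int>\<^sub>\<le>\<^sub>0 :: real set)" by (auto dest: nonpos_Ints_nonpos)
    from Gamma_shift[OF this, of "m + n"] show ?thesis
      by (simp add: pochhammer_product' Gamma_one_half_real add_ac)
  qed
  have P: "(2 * x) powr (- (real (m + n) + 1/2)) = 1 / (2 ^ m * 2 ^ n * x ^ m * x ^ n * (sqrt 2 * sqrt x))"
    unfolding powr_minus_add_half[OF mult_pos_pos[OF zero_less_numeral x]]
    by (simp add: power_mult_distrib power_add real_sqrt_mult mult_ac)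
  have sx: "sqrt (pi * x) = sqrt pi * sqrt x" "sqrt pi * sqrt pi = pi" by (simp_all add: real_sqrt_mult)
  have a: "amp_coeff (5/3) m = (-1) ^ m * pochhammer (- (7/6)) m * pochhammer (13/6) m / (fact m * pochhammer (1/2) m)"
    by (simp add: amp_coeff_def)
  have s: "(- (1 / x)) ^ m * (- (1 / x)) ^ n = (-1) ^ m * (-1) ^ n / (x ^ m * x ^ n)"
  proof -
    have "- (1 / x) = (-1) / x" by simp
    then show ?thesis by (simp only: power_divide times_divide_times_eq)
  qed
  have t: "(- 2 :: real) ^ n = (-1) ^ n * 2 ^ n" by (simp add: power_minus[of 2])
  have "sqrt (pi * x) * (amp_coeff (5/3) m * (-2) ^ n *
      (Gamma (real (m + n) + 1/2) * (2 * x) powr (- (real (m + n) + 1/2))))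
     = (sqrt pi * sqrt pi) / sqrt 2 * (pochhammer (1/2 + real m) n * pochhammer (- (7/6)) m * pochhammer (13/6) m / (2 ^ m * fact m))
      * ((-1) ^ m * (-1) ^ n / (x ^ m * x ^ n))"
    unfolding G P sx(1) a t using x ph by (simp add: divide_simps)
  then show ?thesis unfolding sx(2) s mult.assoc .
qed

text \<open>The prefactor \<open>x\<close> is written as
  \<open>sqrt (x / pi) * sqrt (pi * x)\<close>, and the second root turns the Gaussian moments into
  the terms of \<open>S\<close>. \<open>R\<close> is built from the exact error integral, so the
  identity holds for every \<open>x > 0\<close> and only the size of \<open>R\<close> is
  asymptotic.\<close>

lemma synchrotron_F_asymptotic:
  fixes N :: nat
  defines "S \<equiv> (\<lambda>x. \<Sum>n=0..N. \<Sum>m=0..N.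
             Gamma (1/2 + real n + real m) * Gamma (- (7/6) + real m) * Gamma (13/6 + real m)
               / (2 powr (3/2 + real m) * fact m * Gamma (1/2 + real m))
               * (- (1 / x)) ^ m * (- (1 / x)) ^ n)"
  shows "\<exists>R :: real \<Rightarrow> real. R \<in> O[at_top](\<lambda>x. 1 / x ^ (N + 1)) \<and>
     (\<forall>x>0. synchrotron_F x = sqrt (x / pi) * exp (- x) * (S x + R x))"
proof -
  let ?Q = "\<lambda>w. gauss_amplitude (5/3) w / (1 + 2 * w\<^sup>2)"
  let ?P = "\<lambda>w. \<Sum>n\<le>N. \<Sum>m\<le>N. amp_coeff (5/3) m * (-2) ^ n * w ^ (2 * (m + n))"
  let ?E = "\<lambda>w. ?Q w - ?P w"
  \<comment> \<open>The order is reached from \<open>a = 1/3\<close> by two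
    differentiations.\<close>
  have \<nu>: "5/3 = real 2 - 1/3" by simp
  have iQ: "integrable lborel (\<lambda>w. ?Q w * exp (- (x * (2 * w\<^sup>2))))" if "x > 0" for x
    using bessel_K_tail_gauss(1)[OF _ _ \<nu> that] by simp
  have F: "synchrotron_F x = x * exp (- x) * (LBINT w. ?Q w * exp (- (x * (2 * w\<^sup>2))))" if "x > 0" for x
    unfolding synchrotron_F_def using bessel_K_tail_gauss(2)[OF _ _ \<nu> that] by simp
  have M: "integrable lborel (\<lambda>w. w ^ (2 * k) * exp (- (x * (2 * w\<^sup>2))))"
      "(LBINT w. w ^ (2 * k) * exp (- (x * (2 * w\<^sup>2)))) = Gamma (real k + 1/2) * (2 * x) powr (- (real k + 1/2))"
    if "x > 0" for x k
    using gaussian_moment[of "2 * x" k] that by (simp_all add: mult_ac)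
  have iP: "integrable lborel (\<lambda>w. ?P w * exp (- (x * (2 * w\<^sup>2))))" if "x > 0" for x
    using that unfolding sum_distrib_right mult.assoc
    by (intro Bochner_Integration.integrable_sum integrable_mult_right M)
  have PS: "sqrt (pi * x) * (LBINT w. ?P w * exp (- (x * (2 * w\<^sup>2)))) = S x" if x: "x > 0" for x
  proof -
    have "(LBINT w. ?P w * exp (- (x * (2 * w\<^sup>2))))
       = (\<Sum>n\<le>N. \<Sum>m\<le>N. amp_coeff (5/3) m * (-2) ^ n * (Gamma (real (m + n) + 1/2) * (2 * x) powr (- (real (m + n) + 1/2))))"
      unfolding sum_distrib_right mult.assoc
      by (subst Bochner_Integration.integral_sum, intro Bochner_Integration.integrable_sum integrable_mult_right M x,
        intro sum.cong refl, subst Bochner_Integration.integral_sum, intro integrable_mult_right M x)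
        (simp only: integral_mult_right_zero M(2)[OF x])
    then show ?thesis
      unfolding S_def synchrotron_coefficient atMost_atLeast0
      by (simp only: sum_distrib_left amp_coeff_moment[OF x])
  qed
  obtain C where C: "\<And>w. \<bar>w\<bar> \<le> 1 \<Longrightarrow> \<bar>?E w\<bar> \<le> C * w ^ (2 * Suc N)"
    using gauss_amplitude_quotient_taylor[of "5/3" N] by blast
  have iE: "integrable lborel (\<lambda>w. ?E w * exp (- (x * (2 * w\<^sup>2))))" if "x > 0" for x
    unfolding left_diff_distrib using iQ[OF that] iP[OF that] by (rule Bochner_Integration.integrable_diff)
  obtain K where K: "\<And>x. x \<ge> 1 \<Longrightarrow>
    \<bar>LBINT w. ?E w * exp (- (x * (2 * w\<^sup>2)))\<bar> \<le> K * x powr (- (real (Suc N) + 1/2))"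
    using gaussian_integral_bound[OF C] iE[of 1] by auto
  define R where "R = (\<lambda>x. sqrt (pi * x) * (LBINT w. ?E w * exp (- (x * (2 * w\<^sup>2)))))"
  have "R \<in> O[at_top](\<lambda>x. 1 / x ^ (N + 1))"
  proof (rule bigoI[of _ "sqrt pi * K"])
    show "\<forall>\<^sub>F x in at_top. norm (R x) \<le> sqrt pi * K * norm (1 / x ^ (N + 1))"
      using eventually_ge_at_top[of 1]
    proof eventually_elim
      case (elim x)
      have "norm (R x) = sqrt pi * sqrt x * \<bar>LBINT w. ?E w * exp (- (x * (2 * w\<^sup>2)))\<bar>"
        using elim by (simp add: R_def abs_mult real_sqrt_mult)
      also have "\<dots> \<le> sqrt pi * sqrt x * (K * x powr (- (real (Suc N) + 1/2)))"
        using elim by (intro mult_left_mono K) auto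
      also have "x powr (- (real (Suc N) + 1/2)) = 1 / (x ^ (N + 1) * sqrt x)"
        using elim powr_minus_add_half[of x "Suc N"] by simp
      finally show ?case using elim by (simp add: field_simps)
    qed
  qed
  moreover have "synchrotron_F x = sqrt (x / pi) * exp (- x) * (S x + R x)" if x: "x > 0" for x
  proof -
    have "S x + R x = sqrt (pi * x) * (LBINT w. ?P w * exp (- (x * (2 * w\<^sup>2))) + ?E w * exp (- (x * (2 * w\<^sup>2))))"
      unfolding PS[OF x, symmetric] R_def Bochner_Integration.integral_add[OF iP[OF x] iE[OF x]] by (simp only: distrib_left)
    also have "\<dots> = sqrt (pi * x) * (LBINT w. ?Q w * exp (- (x * (2 * w\<^sup>2))))"
      by (simp only: left_diff_distrib add_diff_eq add_diff_cancel_left')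
    finally have *: "S x + R x = sqrt (pi * x) * (LBINT w. ?Q w * exp (- (x * (2 * w\<^sup>2))))" .
    have sq: "sqrt (x / pi) * sqrt (pi * x) = x" using x by (simp flip: real_sqrt_mult)
    have "sqrt (x / pi) * e * (sqrt (pi * x) * J) = x * e * J" for e J
    proof -
      have "sqrt (x / pi) * e * (sqrt (pi * x) * J) = (sqrt (x / pi) * sqrt (pi * x)) * e * J"
        by (simp only: mult_ac)
      then show ?thesis by (simp only: sq)
    qed
    then show ?thesis by (simp only: F[OF x] *)
  qed
  ultimately show ?thesis by blast
qed

theorem mainTheorem4:
  shows "(\<forall>N::nat. \<exists>R :: real \<Rightarrow> real.
            R \<in> O[at_top](\<lambda>x. 1 / x ^ (N + 1)) \<and>
            (\<forall>x>0. synchrotron_F x = sqrt (x / pi) * exp (- x) *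
               ((\<Sum>n=0..N. \<Sum>m=0..N.
                   Gamma (1/2 + real n + real m) * Gamma (- (7/6) + real m) * Gamma (13/6 + real m)
                     / (2 powr (3/2 + real m) * fact m * Gamma (1/2 + real m))
                     * (- (1 / x)) ^ m * (- (1 / x)) ^ n)
                + R x)))
       \<and> (\<exists>R :: real \<Rightarrow> real.
            R \<in> O[at_top](\<lambda>x. 1 / x ^ 3) \<and>
            (\<forall>x>0. synchrotron_F x = sqrt (pi * x / 2) * exp (- x) *
               (1 + 55/72 * (1 / x) - 10151/10368 * (1 / x ^ 2) + R x)))"
proof (rule conjI[OF allI[OF synchrotron_F_asymptotic]])
  obtain R where R: "R \<in> O[at_top](\<lambda>x. 1 / x ^ 3)"
    "\<And>x. x > 0 \<Longrightarrow> synchrotron_F x = sqrt (x / pi) * exp (- x) * ((\<Sum>n=0..2. \<Sum>m=0..2.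
                   Gamma (1/2 + real n + real m) * Gamma (- (7/6) + real m) * Gamma (13/6 + real m)
                     / (2 powr (3/2 + real m) * fact m * Gamma (1/2 + real m))
                     * (- (1 / x)) ^ m * (- (1 / x)) ^ n) + R x)"
    using synchrotron_F_asymptotic[of 2] by auto
  \<comment> \<open>The double sum for \<open>N = 2\<close> also contains terms of order 3 and 4, which go into the remainder.\<close>
  define R' where "R' = (\<lambda>x. 89635/20736 * (1 / x ^ 3) + 60515/41472 * (1 / x ^ 4) + sqrt 2 / pi * R x)"
  have "R' \<in> O[at_top](\<lambda>x. 1 / x ^ 3)"
  proof -
    have "(\<lambda>x::real. 89635/20736 * (1 / x ^ 3) + 60515/41472 * (1 / x ^ 4)) \<in> O[at_top](\<lambda>x. 1 / x ^ 3)"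
      by real_asymp
    moreover have "(\<lambda>x. sqrt 2 / pi * R x) \<in> O[at_top](\<lambda>x. 1 / x ^ 3)" using R(1) by simp
    ultimately show ?thesis unfolding R'_def by (rule sum_in_bigo)
  qed
  moreover have "synchrotron_F x = sqrt (pi * x / 2) * exp (- x) *
               (1 + 55/72 * (1 / x) - 10151/10368 * (1 / x ^ 2) + R' x)" if x: "x > 0" for x
  proof -
    define z where "z = 1 / x"
    have "(\<Sum>n=0..2. \<Sum>m=0..2.
        pi / sqrt 2 * (pochhammer (1/2 + real m) n * pochhammer (- (7/6)) m * pochhammer (13/6) m / (2 ^ m * fact m))
          * (- z) ^ m * (- z) ^ n)
      = pi / sqrt 2 * (\<Sum>n=0..2. \<Sum>m=0..2.
        pochhammer (1/2 + real m) n * pochhammer (- (7/6)) m * pochhammer (13/6) m / (2 ^ m * fact m)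
          * (- z) ^ m * (- z) ^ n)"
      by (simp only: sum_distrib_left mult.assoc)
    also have "(\<Sum>n=0..2. \<Sum>m=0..2.
        pochhammer (1/2 + real m) n * pochhammer (- (7/6)) m * pochhammer (13/6) m / (2 ^ m * fact m)
          * (- z) ^ m * (- z) ^ n)
      = 1 + 55/72 * z - 10151/10368 * z ^ 2 + 89635/20736 * z ^ 3 + 60515/41472 * z ^ 4"
      by (simp add: numeral_2_eq_2 pochhammer_Suc) (simp add: algebra_simps eval_nat_numeral)
    finally have S: "(\<Sum>n=0..2. \<Sum>m=0..2.
                   Gamma (1/2 + real n + real m) * Gamma (- (7/6) + real m) * Gamma (13/6 + real m)
                     / (2 powr (3/2 + real m) * fact m * Gamma (1/2 + real m))
                     * (- (1 / x)) ^ m * (- (1 / x)) ^ n)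
      = pi / sqrt 2 * (1 + 55/72 * (1 / x) - 10151/10368 * (1 / x ^ 2) + 89635/20736 * (1 / x ^ 3) + 60515/41472 * (1 / x ^ 4))"
      unfolding synchrotron_coefficient z_def by (simp add: power_one_over)
    \<comment> \<open>The constant \<open>pi / sqrt 2\<close> taken out of the sum moves into the
      square root; the factor \<open>sqrt 2 / pi\<close> at \<open>R x\<close> in \<open>R'\<close>
      compensates for it.\<close>
    have rt: "sqrt (x / pi) * (pi / sqrt 2) = sqrt (pi * x / 2)"
      using x by (simp add: real_sqrt_mult real_sqrt_divide field_simps)
    have "synchrotron_F x = sqrt (x / pi) * exp (- x) * (pi / sqrt 2 *
        (1 + 55/72 * (1 / x) - 10151/10368 * (1 / x ^ 2) + R' x))"
      unfolding R(2)[OF x] S R'_def by (simp add: distrib_left)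
    then show ?thesis unfolding rt[symmetric] by (simp only: mult_ac)
  qed
  ultimately show "\<exists>R :: real \<Rightarrow> real.
            R \<in> O[at_top](\<lambda>x. 1 / x ^ 3) \<and>
            (\<forall>x>0. synchrotron_F x = sqrt (pi * x / 2) * exp (- x) *
               (1 + 55/72 * (1 / x) - 10151/10368 * (1 / x ^ 2) + R x))" by blast
qed

end
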